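(* Let $n\in\mathbb{N}$ and suppose the kernel $K\in L_1$ satisfies condition $B_n^*$; let $T^*\in\mathcal{T}_n$ be the polynomial from this condition. Then for all $s=0,1,\ldots,n$ $$\sup_{f\in \mathbf{W}_{\infty,s}(K)}E_n(f)_\infty=\sup_{f\in \mathbf{W}_{\infty,n}(K)}\|f\|_\infty=\frac{1}{2\pi}E_n(K)_1=\frac{1}{2\pi}\|K-T^*\|_1$$ and $$\sup_{f\in \mathbf{W}_{1,s}(K)}E_n(f)_1=\sup_{f\in \mathbf{W}_{1,n}(K)}\|f\|_1=\frac{1}{2\pi}E_n(K)_1=\frac{1}{2\pi}\|K-T^*\|_1 .$$
   Context: $\mathbb{N}=\{1,2,\dots\}$. $L_p$, $1\le p\le\infty$, is the space of $2\pi$-periodic real-valued measurable functions with finite norm $\|f\|_p=(\int_{-\pi}^{\pi}|f(t)|^p\,dt)^{1/p}$ for $p<\infty$ and $\|f\|_\infty=\operatorname{ess\,sup}_{[-\pi,\pi]}|f|$. Fourier coefficients: $\widehat{\varphi}(k)=\frac1{2\pi}\int_{-\pi}^{\pi}\varphi(t)e^{-ikt}\,dt$, $k\in\mathbb{Z}$. For $n\in\mathbb{N}$, $\mathcal{T}_n$ is the set of real trigonometric polynomials $\frac{\alpha_0}{2}+\sum_{k=1}^{n-1}(\alpha_k\cos kt+\beta_k\sin kt)$, $\alpha_k,\beta_k\in\mathbb{R}$ (degree at most $n-1$), and $E_n(f)_p=\inf_{T\in\mathcal{T}_n}\|f-T\|_p$. $H_p^0=\{\varphi\in L_p:\|\varphi\|_p\le1\}$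 and, for $n\in\mathbb{N}$, $H_p^n=\{\varphi\in H_p^0:\widehat\varphi(k)=0\text{ for all }k\in\mathbb{Z},\ |k|\le n-1\}$. For $K\in L_1$ and an integer $n\ge0$, $\mathbf{W}_{p,n}(K)$ is the class of all functions $f(x)=\frac1{2\pi}\int_{-\pi}^{\pi}\varphi(x-t)K(t)\,dt$ with $\varphi\in H_p^n$. A function $K\in L_1$ satisfies condition $B_n^*$, $n\in\mathbb{N}$, if there exist $T^*\in\mathcal{T}_n$, a function $\varphi_*\in L_\infty$ and a natural number $n_*\ge n$ such that almost everywhere $|\varphi_*(t)|\le1$, $\varphi_*(t)(K(t)-T^*(t))=|K(t)-T^*(t)|$ and $\varphi_*(t+\pi/n_* )=-\varphi_*(t)$. *)

theory Defs
  imports "HOL-Analysis.Analysis" "HOL-Probability.Essential_Supremum"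
begin

text \<open>
  Elements of \<open>L\<^sub>p\<close> are represented by everywhere defined functions on the line; norms, errors of
  approximation and suprema take values in \<open>ennreal\<close>, so that no supremum or infimum has to be
  accompanied by a boundedness side condition. The exponent ranges over \<open>1 \<le> p \<le> \<infinity>\<close>.
\<close>

definition Lp_norm :: "ennreal \<Rightarrow> (real \<Rightarrow> real) \<Rightarrow> ennreal" where
  "Lp_norm p f =
     (if p = \<infinity> then esssup (lebesgue_on {-pi..pi}) (\<lambda>t. ennreal \<bar>f t\<bar>)
      else let I = (\<integral>\<^sup>+t. ennreal (\<bar>f t\<bar> powr enn2real p) \<partial>lebesgue_on {-pi..pi})
           in if I = \<infinity> then \<infinity> else ennreal (enn2real I powr (1 / enn2real p)))"

definition Lp :: "ennreal \<Rightarrow> (real \<Rightarrow> real) set" where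
  "Lp p = {f. f \<in> borel_measurable lebesgue \<and> (\<forall>t. f (t + 2 * pi) = f t) \<and> Lp_norm p f < \<infinity>}"

definition fourier_coeff :: "(real \<Rightarrow> real) \<Rightarrow> int \<Rightarrow> complex" where
  "fourier_coeff \<phi> k =
     1 / (2 * of_real pi) *
     (LINT t|lebesgue_on {-pi..pi}. of_real (\<phi> t) * exp (- \<i> * of_int k * of_real t))"

definition trig_polys :: "nat \<Rightarrow> (real \<Rightarrow> real) set" where
  "trig_polys n =
     {T. \<exists>\<alpha> \<beta> :: nat \<Rightarrow> real.
        T = (\<lambda>t. \<alpha> 0 / 2 + (\<Sum>k = 1..<n. \<alpha> k * cos (real k * t) + \<beta> k * sin (real k * t)))}"

definition best_approx :: "nat \<Rightarrow> ennreal \<Rightarrow> (real \<Rightarrow> real) \<Rightarrow> ennreal" where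
  "best_approx n p f = (INF T\<in>trig_polys n. Lp_norm p (\<lambda>t. f t - T t))"

text \<open>The bound below is an integer, so for \<open>n = 0\<close> it is \<open>-1\<close>, the spectral condition is void
  and \<open>H_ball p 0\<close> is the whole unit ball.\<close>

definition H_ball :: "ennreal \<Rightarrow> nat \<Rightarrow> (real \<Rightarrow> real) set" where
  "H_ball p n =
     {\<phi> \<in> Lp p. Lp_norm p \<phi> \<le> 1 \<and> (\<forall>k::int. \<bar>k\<bar> \<le> int n - 1 \<longrightarrow> fourier_coeff \<phi> k = 0)}"

text \<open>For \<open>p < \<infinity>\<close> the convolution integral may diverge for \<open>x\<close> in a null set, where the Bochner
  integral is \<open>0\<close> by convention; this does not affect any \<open>L\<^sub>p\<close> norm.\<close>

definition conv_class :: "ennreal \<Rightarrow> nat \<Rightarrow> (real \<Rightarrow> real) \<Rightarrow> (real \<Rightarrow> real) set" where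
  "conv_class p n K =
     {f. \<exists>\<phi>\<in>H_ball p n.
        f = (\<lambda>x. 1 / (2 * pi) * (LINT t|lebesgue_on {-pi..pi}. \<phi> (x - t) * K t))}"

text \<open>\<open>B_star_with n K T\<close>: \<open>K\<close> satisfies condition \<open>B\<^sub>n\<^sup>*\<close>, with \<open>T\<close> as the polynomial \<open>T\<^sup>*\<close>.\<close>

definition B_star_with :: "nat \<Rightarrow> (real \<Rightarrow> real) \<Rightarrow> (real \<Rightarrow> real) \<Rightarrow> bool" where
  "B_star_with n K T \<longleftrightarrow>
     T \<in> trig_polys n \<and>
     (\<exists>\<phi>\<in>Lp \<infinity>. \<exists>m\<ge>n. AE t in lebesgue.
        \<bar>\<phi> t\<bar> \<le> 1 \<and> \<phi> t * (K t - T t) = \<bar>K t - T t\<bar> \<and> \<phi> (t + pi / real m) = - \<phi> t)"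

end

(* Proof. Testing against the sign function psi of condition B_n^*, which is antiperiodic with
   half-period pi/m (m >= n) and hence orthogonal to T_n, gives E_n(K)_1 = ||K - T||_1 =: M by
   duality. Convolution with T maps into T_n and annihilates functions orthogonal to T_n, so
   Young's inequality for the kernel K - T bounds both suprema by M/(2 pi).

   Sharpness is governed by G(u) = int K(t) psi(u + t) dt: it is continuous, G(u + pi/m) = -G(u)
   and G(0) = M. A function phi of unit L_1 norm with the same antiperiodicity, concentrated near
   the points of (pi/m)Z, therefore makes int phi G as close to M as desired. For p = 1 one uses
   f = phi * K and bounds E_n(f)_1 from below by testing f against psi; for p = infinity one uses
   f(x) = G(-x)/(2 pi), the convolution of K with psi(-t), tested against phi(-t). *)
theory Submission
  imports Defs
begin

section \<open>Functions on the circle\<close>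

text \<open>The extremal object behind the lower bounds is not a function. Point masses of
  alternating sign (-1)^j at the points j \<pi>/m, normalised to total variation 1 on one period,
  integrate G to exactly M, but they lie outside L_1. Smearing them over small neighbourhoods costs
  an error \<delta> that continuity of G at 0 controls; the smearing has to keep the
  antiperiodicity, which is what makes the result orthogonal to T_n. For p = 1 the smeared masses
  are themselves members of the class. For p = \<infinity> the reflected sign function is the
  member, one and the same for every \<delta>, and the smeared masses only serve as functionals of
  norm 1. One Fubini identity links G with the first case: \<integral> \<psi> conv(\<phi>, K) =
  (1/(2\<pi>)) \<integral> \<phi> G.

  The given data are Lebesgue measurable and their relations hold almost everywhere, whereas Fubini
  asks for joint measurability. The estimates are therefore proved for Borel representatives, and
  the classes are shown to be unchanged, as sets of functions, by this replacement.\<close>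

abbreviation circ :: "real measure" where "circ \<equiv> lebesgue_on {-pi..pi}"

definition periodic :: "(real \<Rightarrow> 'a) \<Rightarrow> bool" where
  "periodic f \<longleftrightarrow> (\<forall>t. f (t + 2 * pi) = f t)"

text \<open>Value type and period are arbitrary because the lemma serves real functions of period
  \<open>2 * pi\<close> as well as a pair-valued map whose period is the half-period of the sign
  function.\<close>

lemma add_int_mult_period:
  fixes f :: "real \<Rightarrow> 'a"
  assumes p: "\<And>t. f (t + p) = f t"
  shows "f (t + p * of_int k) = f t"
proof (induction k rule: int_induct[where k=0])
  case base then show ?case by simp
next
  case (step1 i)
  then show ?case using p[of "t + p * of_int i"] by (simp add: algebra_simps)
next
  case (step2 i)
  then show ?case using p[of "t + p * of_int (i - 1)"] by (simp add: algebra_simps)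
qed

lemma periodic_int: "periodic f \<Longrightarrow> f (t + 2 * pi * of_int k) = f t"
  by (rule add_int_mult_period) (simp add: periodic_def)

lemma periodic_shift:
  assumes "periodic f" shows "periodic (\<lambda>x. f (x + c))"
proof -
  have "f (t + 2 * pi + c) = f (t + c)" for t
    using periodic_int[OF assms, of "t + c" 1] by (simp add: algebra_simps)
  then show ?thesis by (simp add: periodic_def)
qed

lemma periodic_reflect:
  assumes "periodic f" shows "periodic (\<lambda>x. f (c - x))"
proof -
  have "f (c - (t + 2 * pi)) = f (c - t)" for t
    using periodic_int[OF assms, of "c - t" "-1"] by (simp add: algebra_simps)
  then show ?thesis by (simp add: periodic_def)
qed

lemma borel_imp_circ: "f \<in> measurable borel N \<Longrightarrow> f \<in> measurable circ N"
  by (rule measurable_restrict_space1, rule measurable_completion) simp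

text \<open>Measurable identity maps say that \<open>M\<close> and \<open>M'\<close> carry finer
  \<sigma>-algebras than \<open>A\<close> and \<open>B\<close>. In this way jointly Borel functions
  become measurable for Fubini on \<open>circ\<close>.\<close>

lemma measurable_pair_mono:
  assumes "f \<in> measurable (A \<Otimes>\<^sub>M B) N" "(\<lambda>x. x) \<in> measurable M A" "(\<lambda>x. x) \<in> measurable M' B"
  shows "f \<in> measurable (M \<Otimes>\<^sub>M M') N"
proof -
  have "(\<lambda>p. (fst p, snd p)) \<in> M \<Otimes>\<^sub>M M' \<rightarrow>\<^sub>M A \<Otimes>\<^sub>M B"
    by (intro measurable_Pair measurable_compose[OF measurable_fst assms(2)]
        measurable_compose[OF measurable_snd assms(3)])
  then have "(\<lambda>p. f (fst p, snd p)) \<in> measurable (M \<Otimes>\<^sub>M M') N"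
    using assms(1) by (rule measurable_compose)
  then show ?thesis by (simp only: prod.collapse)
qed

lemma borel_imp_circ_pair:
  "f \<in> measurable (borel \<Otimes>\<^sub>M borel) N \<Longrightarrow> f \<in> measurable (circ \<Otimes>\<^sub>M circ) N"
  by (erule measurable_pair_mono) (auto intro: borel_imp_circ)

section \<open>Integrals over one period under shifts and reflections\<close>

lemma finite_measure_circ: "finite_measure circ"
  by (rule finite_measureI) (simp add: emeasure_restrict_space)

lemma nn_integral_circ:
  "(\<integral>\<^sup>+x. f x \<partial>circ) = (\<integral>\<^sup>+x. f x * indicator {-pi..pi} x \<partial>lborel)"
  by (simp add: nn_integral_restrict_space nn_integral_completion)

text \<open>Whole periods move the second window until it starts inside the first one; the piece
  sticking out on the right is then shifted back by one period and fills the gap on the left.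
  Half-open windows fit together without overlap.\<close>

lemma nn_integral_period_eq:
  fixes f :: "real \<Rightarrow> ennreal"
  assumes f [measurable]: "f \<in> borel_measurable borel" and p: "periodic f"
  shows "(\<integral>\<^sup>+x. f x * indicator {a..<a + 2 * pi} x \<partial>lborel)
       = (\<integral>\<^sup>+x. f x * indicator {b..<b + 2 * pi} x \<partial>lborel)"
proof -
  define W where "W a b = (\<integral>\<^sup>+x. f x * indicator {a..<b} x \<partial>lborel)" for a b
  have sh: "W (a + 2 * pi * of_int k) (b + 2 * pi * of_int k) = W a b" for a b k
  proof -
    have "W (a + 2 * pi * of_int k) (b + 2 * pi * of_int k) =
       (\<integral>\<^sup>+x. f (2 * pi * of_int k + x) * indicator {a + 2 * pi * of_int k..<b + 2 * pi * of_int k} (2 * pi * of_int k + x) \<partial>lborel)"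
      unfolding W_def by (subst nn_integral_real_affine[where c=1 and t="2 * pi * of_int k"]) auto
    also have "\<dots> = W a b" unfolding W_def
      by (intro nn_integral_cong)
        (auto simp: periodic_int[OF p] add.commute[of "2 * pi * of_int k"] split: split_indicator)
    finally show ?thesis .
  qed
  have split: "W a c = W a b + W b c" if "a \<le> b" "b \<le> c" for a b c
    unfolding W_def using that
    by (subst nn_integral_add[symmetric]) (auto intro!: nn_integral_cong split: split_indicator)
  define k where "k = \<lfloor>(b - a) / (2 * pi)\<rfloor>"
  define b' where "b' = b - 2 * pi * of_int k"
  have "of_int k \<le> (b - a) / (2 * pi)" "(b - a) / (2 * pi) < of_int k + 1"
    unfolding k_def by linarith+
  then have b': "a \<le> b'" "b' \<le> a + 2 * pi"
    unfolding b'_def by (auto simp: field_simps)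
  have "W b (b + 2 * pi) = W (b' + 2 * pi * of_int k) ((b' + 2 * pi) + 2 * pi * of_int k)"
    by (simp add: b'_def)
  also have "\<dots> = W b' (b' + 2 * pi)" by (rule sh)
  also have "\<dots> = W b' (a + 2 * pi) + W (a + 2 * pi) (b' + 2 * pi)"
    using b' by (intro split) auto
  also have "W (a + 2 * pi) (b' + 2 * pi) = W a b'" using sh[of a 1 b'] by simp
  also have "W b' (a + 2 * pi) + W a b' = W a (a + 2 * pi)"
    using split[OF b'] by (simp add: add.commute)
  finally show ?thesis unfolding W_def by simp
qed

lemma nn_integral_circ_shift:
  fixes f :: "real \<Rightarrow> ennreal"
  assumes f [measurable]: "f \<in> borel_measurable borel" and p: "periodic f"
  shows "(\<integral>\<^sup>+x. f (x + c) \<partial>circ) = (\<integral>\<^sup>+x. f x \<partial>circ)"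
proof -
  have *: "(\<integral>\<^sup>+x. f (x + c) \<partial>circ) = (\<integral>\<^sup>+x. f x * indicator {c - pi..<c - pi + 2 * pi} x \<partial>lborel)" for c
  proof -
    \<comment> \<open>The window of \<open>circ\<close> is closed; dropping its right end point
      costs a null set and gives the half-open form.\<close>
    have "(\<integral>\<^sup>+x. f (x + c) \<partial>circ) = (\<integral>\<^sup>+x. f (x + c) * indicator {-pi..<pi} x \<partial>lborel)"
      unfolding nn_integral_circ
      by (intro nn_integral_cong_AE eventually_mono[OF AE_lborel_singleton[of pi]])
        (auto simp: indicator_def)
    also have "\<dots> = (\<integral>\<^sup>+x. f (c + 1 * x) * indicator {c - pi..<c - pi + 2 * pi} (c + 1 * x) \<partial>lborel)"
      by (intro nn_integral_cong) (simp add: add.commute[of _ c] indicator_def)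
    also have "\<dots> = (\<integral>\<^sup>+x. f x * indicator {c - pi..<c - pi + 2 * pi} x \<partial>lborel)"
      by (subst (2) nn_integral_real_affine[where c=1 and t=c]) auto
    finally show ?thesis .
  qed
  show ?thesis using nn_integral_period_eq[OF f p, of "c - pi" "0 - pi"]
    unfolding *[of c, symmetric] *[of 0, symmetric] by simp
qed

lemma nn_integral_circ_uminus:
  fixes f :: "real \<Rightarrow> ennreal"
  assumes f [measurable]: "f \<in> borel_measurable borel"
  shows "(\<integral>\<^sup>+x. f (- x) \<partial>circ) = (\<integral>\<^sup>+x. f x \<partial>circ)"
proof -
  have "(\<integral>\<^sup>+x. f x \<partial>circ) = (\<integral>\<^sup>+x. f (0 + - 1 * x) * indicator {-pi..pi} (0 + - 1 * x) \<partial>lborel)"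
    unfolding nn_integral_circ by (subst nn_integral_real_affine[where c="- 1" and t=0]) simp_all
  also have "\<dots> = (\<integral>\<^sup>+x. f (- x) \<partial>circ)"
    unfolding nn_integral_circ by (intro nn_integral_cong) (auto simp: indicator_def)
  finally show ?thesis by simp
qed

lemma nn_integral_circ_reflect:
  fixes f :: "real \<Rightarrow> ennreal"
  assumes f [measurable]: "f \<in> borel_measurable borel" and p: "periodic f"
  shows "(\<integral>\<^sup>+x. f (c - x) \<partial>circ) = (\<integral>\<^sup>+x. f x \<partial>circ)"
  using nn_integral_circ_uminus[of "\<lambda>x. f (x + c)"] nn_integral_circ_shift[OF f p, of c] by simp

text \<open>\<open>ennreal\<close> cuts negative values to 0, so the hypotheses compare positive and
  negative parts. No integrability is assumed: if one side is not integrable, neither is the other,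
  and both integrals have the default value 0.\<close>

lemma integral_eq_from_nn_integral:
  fixes f :: "'a \<Rightarrow> real" and g :: "'b \<Rightarrow> real"
  assumes "f \<in> borel_measurable M" "g \<in> borel_measurable N"
    and "(\<integral>\<^sup>+x. ennreal (f x) \<partial>M) = (\<integral>\<^sup>+x. ennreal (g x) \<partial>N)"
    and "(\<integral>\<^sup>+x. ennreal (- f x) \<partial>M) = (\<integral>\<^sup>+x. ennreal (- g x) \<partial>N)"
  shows "integrable M f \<longleftrightarrow> integrable N g" "integral\<^sup>L M f = integral\<^sup>L N g"
proof -
  show 1: "integrable M f \<longleftrightarrow> integrable N g" unfolding real_integrable_def using assms by auto
  show "integral\<^sup>L M f = integral\<^sup>L N g"
    using 1 assms by (cases "integrable M f") (auto simp: real_lebesgue_integral_def not_integrable_integral_eq)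
qed

lemma
  fixes f :: "real \<Rightarrow> real"
  assumes f [measurable]: "f \<in> borel_measurable borel" and p: "periodic f"
  shows integral_circ_shift: "(LINT x|circ. f (x + c)) = (LINT x|circ. f x)"
    and integrable_circ_reflect: "integrable circ (\<lambda>x. f (c - x)) \<longleftrightarrow> integrable circ f"
    and integral_circ_reflect: "(LINT x|circ. f (c - x)) = (LINT x|circ. f x)"
proof -
  have pp: "periodic (\<lambda>x. ennreal (f x))" "periodic (\<lambda>x. ennreal (- f x))"
    using p by (auto simp: periodic_def)
  have m: "(\<lambda>x. f (x + c)) \<in> borel_measurable circ" "(\<lambda>x. f (c - x)) \<in> borel_measurable circ"
     "f \<in> borel_measurable circ"
    by (auto intro!: borel_imp_circ)
  have me: "(\<lambda>x. ennreal (f x)) \<in> borel_measurable borel" "(\<lambda>x. ennreal (- f x)) \<in> borel_measurable borel"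
    by measurable
  note sh = integral_eq_from_nn_integral[OF m(1) m(3) nn_integral_circ_shift[OF me(1) pp(1)]
      nn_integral_circ_shift[OF me(2) pp(2)]]
  note re = integral_eq_from_nn_integral[OF m(2) m(3) nn_integral_circ_reflect[OF me(1) pp(1)]
      nn_integral_circ_reflect[OF me(2) pp(2)]]
  show "(LINT x|circ. f (x + c)) = (LINT x|circ. f x)"
    "integrable circ (\<lambda>x. f (c - x)) \<longleftrightarrow> integrable circ f"
    "(LINT x|circ. f (c - x)) = (LINT x|circ. f x)"
    using sh re by blast+
qed

text \<open>The indicator of the exceptional set is periodic with integral 0, and shifts and
  reflections preserve this integral.\<close>

lemma
  assumes Q [measurable]: "Measurable.pred borel Q" and p: "periodic Q" and ae: "AE x in circ. Q x"
  shows AE_circ_shift: "AE x in circ. Q (x + c)"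
    and AE_circ_reflect: "AE x in circ. Q (c - x)"
proof -
  define f where "f x = (indicator {x. \<not> Q x} x :: ennreal)" for x
  have f [measurable]: "f \<in> borel_measurable borel" unfolding f_def by measurable
  have pf: "periodic f" using p by (auto simp: periodic_def f_def indicator_def)
  have Qf: "Q x \<longleftrightarrow> f x = 0" for x by (auto simp: f_def indicator_def)
  have i: "(\<integral>\<^sup>+x. f x \<partial>circ) = 0"
    using ae unfolding Qf by (subst nn_integral_0_iff_AE) (auto intro: borel_imp_circ)
  have m: "(\<lambda>x. f (x + c)) \<in> borel_measurable circ" "(\<lambda>x. f (c - x)) \<in> borel_measurable circ"
    by (auto intro!: borel_imp_circ)
  show "AE x in circ. Q (x + c)"
    unfolding Qf using i nn_integral_circ_shift[OF f pf, of c] nn_integral_0_iff_AE[OF m(1)] by simp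
  show "AE x in circ. Q (c - x)"
    unfolding Qf using i nn_integral_circ_reflect[OF f pf, of c] nn_integral_0_iff_AE[OF m(2)] by simp
qed

lemma AE_lborel_affine:
  fixes t c :: real
  assumes ae: "AE x in lborel. Q x" and c: "c \<noteq> 0"
  shows "AE x in lborel. Q (t + c * x)"
proof -
  obtain N where N: "{x. \<not> Q x} \<subseteq> N" "N \<in> null_sets lborel"
    using ae unfolding eventually_ae_filter by auto
  have [measurable]: "N \<in> sets borel" using N(2) by (auto simp: null_sets_def)
  have "AE x in lborel. x \<notin> N" using N(2) by (rule AE_not_in)
  then have "AE x in lborel. t + c * x \<notin> N" using c by (intro AE_borel_affine) auto
  then show ?thesis by eventually_elim (use N(1) in blast)
qed

text \<open>Lebesgue measurable functions are replaced by Borel ones because \<open>(x, t) \<mapsto> f (x - t)\<close> need not be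
  measurable for the product of two Lebesgue \<open>\<sigma>\<close>-algebras when \<open>f\<close> is only Lebesgue measurable.\<close>

lemma periodic_borel_version:
  fixes f :: "real \<Rightarrow> real"
  assumes f: "f \<in> borel_measurable lebesgue" and p: "periodic f"
  obtains g where "g \<in> borel_measurable borel" "periodic g" "AE x in lebesgue. f x = g x"
proof -
  obtain h where h: "h \<in> borel_measurable lborel" and fh: "AE x in lborel. f x = h x"
    using completion_ex_borel_measurable_real[OF f] by auto
  have hm [measurable]: "h \<in> borel_measurable borel" using h by simp
  \<comment> \<open>\<open>r\<close> reduces to \<open>[0, 2 pi)\<close>, so composing
    \<open>h\<close> with it gives exact periodicity. Agreement with \<open>f\<close> survives
    because the countably many translates of the exceptional set by multiples of \<open>2 pi\<close>
    still form a null set.\<close>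
  define r where "r x = x - 2 * pi * of_int \<lfloor>x / (2 * pi)\<rfloor>" for x :: real
  have r_eq: "r x = x + 2 * pi * of_int (- \<lfloor>x / (2 * pi)\<rfloor>)" for x by (simp add: r_def)
  have [measurable]: "r \<in> borel_measurable borel" unfolding r_def by measurable
  have "AE x in lborel. f (x + 2 * pi * of_int k) = h (x + 2 * pi * of_int k)" for k :: int
    using AE_lborel_affine[OF fh, of 1 "2 * pi * of_int k"] by (simp add: add.commute)
  then have "AE x in lborel. \<forall>k::int. f (x + 2 * pi * of_int k) = h (x + 2 * pi * of_int k)"
    by (subst AE_all_countable) auto
  then have "AE x in lborel. f x = h (r x)"
    by eventually_elim (metis p periodic_int r_eq)
  then have "AE x in lebesgue. f x = h (r x)" by (simp add: AE_completion)
  moreover have "periodic (\<lambda>x. h (r x))"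
  proof -
    have "(x + 2 * pi) / (2 * pi) = x / (2 * pi) + 1" for x by (simp add: field_simps)
    then have "r (x + 2 * pi) = r x" for x unfolding r_def by (simp add: algebra_simps)
    then show ?thesis by (simp add: periodic_def)
  qed
  ultimately show thesis using that[of "\<lambda>x. h (r x)"] by simp
qed

lemma AE_lebesgue_imp_circ: "AE x in lebesgue. Q x \<Longrightarrow> AE x in circ. Q x"
  by (subst AE_restrict_space_iff) auto

section \<open>Norms for the exponents 1 and \<infinity>, and products with bounded
  functions\<close>

lemma Lp_norm_1: "Lp_norm 1 f = (\<integral>\<^sup>+t. ennreal \<bar>f t\<bar> \<partial>circ)"
  by (auto simp: Lp_norm_def Let_def less_top)

lemma Lp_norm_infinity: "Lp_norm \<infinity> f = esssup circ (\<lambda>t. ennreal \<bar>f t\<bar>)"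
  by (simp add: Lp_norm_def)

lemma integrable_mult_bounded:
  fixes f g :: "'a \<Rightarrow> real"
  assumes "integrable M f" "g \<in> borel_measurable M" "AE x in M. \<bar>g x\<bar> \<le> B"
  shows "integrable M (\<lambda>x. f x * g x)"
proof (rule Bochner_Integration.integrable_bound[where f="\<lambda>x. B * f x"])
  show "AE x in M. norm (f x * g x) \<le> norm (B * f x)"
    using assms(3)
  proof eventually_elim
    case (elim x)
    then have "\<bar>f x\<bar> * \<bar>g x\<bar> \<le> \<bar>f x\<bar> * \<bar>B\<bar>" by (intro mult_left_mono) auto
    then show ?case by (simp add: abs_mult mult.commute)
  qed
qed (use assms in \<open>auto intro: borel_measurable_integrable\<close>)

section \<open>Trigonometric polynomials and orthogonality\<close>

lemma trig_polys_add:
  assumes "S \<in> trig_polys n" "T \<in> trig_polys n"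
  shows "(\<lambda>t. S t + T t) \<in> trig_polys n"
proof -
  obtain a b c d where
    "S = (\<lambda>t. a 0 / 2 + (\<Sum>k = 1..<n. a k * cos (real k * t) + b k * sin (real k * t)))"
    "T = (\<lambda>t. c 0 / 2 + (\<Sum>k = 1..<n. c k * cos (real k * t) + d k * sin (real k * t)))"
    using assms unfolding trig_polys_def by blast
  then show ?thesis unfolding trig_polys_def
    by (intro CollectI exI[of _ "\<lambda>k. a k + c k"] exI[of _ "\<lambda>k. b k + d k"])
      (auto simp: fun_eq_iff add_divide_distrib algebra_simps sum.distrib)
qed

lemma trig_polys_scale:
  assumes "S \<in> trig_polys n"
  shows "(\<lambda>t. c * S t) \<in> trig_polys n"
proof -
  obtain a b where
    "S = (\<lambda>t. a 0 / 2 + (\<Sum>k = 1..<n. a k * cos (real k * t) + b k * sin (real k * t)))"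
    using assms unfolding trig_polys_def by blast
  then show ?thesis unfolding trig_polys_def
    by (intro CollectI exI[of _ "\<lambda>k. c * a k"] exI[of _ "\<lambda>k. c * b k"])
      (auto simp: fun_eq_iff algebra_simps sum_distrib_left)
qed

lemma trig_polys_diff:
  assumes "S \<in> trig_polys n" "T \<in> trig_polys n"
  shows "(\<lambda>t. S t - T t) \<in> trig_polys n"
  using trig_polys_add[OF assms(1) trig_polys_scale[OF assms(2), of "-1"]] by simp

lemma trig_polys_zero: "(\<lambda>t. 0) \<in> trig_polys n"
  unfolding trig_polys_def by (intro CollectI exI[of _ "\<lambda>k. 0"]) simp

lemma trig_polys_cos:
  assumes "k < n" shows "(\<lambda>t. cos (real k * t)) \<in> trig_polys n"
proof (cases "k = 0")
  case True
  then show ?thesis unfolding trig_polys_def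
    by (intro CollectI exI[of _ "\<lambda>k. if k = 0 then 2 else 0"] exI[of _ "\<lambda>k. 0"]) auto
next
  case False
  have "(\<Sum>j = 1..<n. (if j = k then 1 else 0) * cos (real j * t) + 0 * sin (real j * t)) = cos (real k * t)" for t
    using assms False by (subst sum.mono_neutral_cong_right[where S="{k}" and h="\<lambda>j. cos (real k * t)"]) auto
  then show ?thesis unfolding trig_polys_def using False
    by (intro CollectI exI[of _ "\<lambda>j. if j = k then 1 else 0"] exI[of _ "\<lambda>k. 0"]) auto
qed

lemma trig_polys_sin:
  assumes "k < n" shows "(\<lambda>t. sin (real k * t)) \<in> trig_polys n"
proof (cases "k = 0")
  case True
  then show ?thesis using trig_polys_zero by simp
next
  case False
  have "(\<Sum>j = 1..<n. 0 * cos (real j * t) + (if j = k then 1 else 0) * sin (real j * t)) = sin (real k * t)" for t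
    using assms False by (subst sum.mono_neutral_cong_right[where S="{k}" and h="\<lambda>j. sin (real k * t)"]) auto
  then show ?thesis unfolding trig_polys_def using False
    by (intro CollectI exI[of _ "\<lambda>j. 0"] exI[of _ "\<lambda>j. if j = k then 1 else 0"]) auto
qed

text \<open>The space is spanned by the cosines and sines of order \<open>k < n\<close>, constants
  being multiples of \<open>cos 0\<close>. For \<open>n = 0\<close> the definition still contains
  all constants while no such \<open>k\<close> exists, hence \<open>n \<ge> 1\<close>.\<close>

lemma trig_polys_induct [consumes 2, case_names cos sin add scale]:
  assumes "T \<in> trig_polys n" "n \<ge> 1"
    and c: "\<And>k. k < n \<Longrightarrow> P (\<lambda>t. cos (real k * t))"
    and s: "\<And>k. k < n \<Longrightarrow> P (\<lambda>t. sin (real k * t))"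
    and add: "\<And>S T. S \<in> trig_polys n \<Longrightarrow> T \<in> trig_polys n \<Longrightarrow> P S \<Longrightarrow> P T \<Longrightarrow> P (\<lambda>t. S t + T t)"
    and scale: "\<And>S c. S \<in> trig_polys n \<Longrightarrow> P S \<Longrightarrow> P (\<lambda>t. c * S t)"
  shows "P T"
proof -
  \<comment> \<open>Membership is carried along with \<open>P\<close>, since the hypotheses on sums
    and multiples ask for it.\<close>
  define Q where "Q T \<longleftrightarrow> T \<in> trig_polys n \<and> P T" for T
  have Qc: "Q (\<lambda>t. cos (real k * t))" and Qs: "Q (\<lambda>t. sin (real k * t))" if "k < n" for k
    using c s that by (auto simp: Q_def trig_polys_cos trig_polys_sin)
  have Qadd: "Q (\<lambda>t. S t + T t)" if "Q S" "Q T" for S T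
    using add that by (auto simp: Q_def trig_polys_add)
  have Qscale: "Q (\<lambda>t. c * S t)" if "Q S" for S c
    using scale that by (auto simp: Q_def trig_polys_scale)
  have Qsum: "Q (\<lambda>t. \<Sum>k\<in>F. a k * cos (real k * t) + b k * sin (real k * t))"
    if "finite F" "F \<subseteq> {..<n}" for F a b
    using that
  proof (induction F)
    case empty
    then show ?case using Qscale[OF Qc, of 0 0] assms(2) by simp
  next
    case (insert k F)
    then show ?case by (simp add: Qadd Qscale Qc Qs)
  qed
  obtain a b where
    T: "T = (\<lambda>t. a 0 / 2 + (\<Sum>k = 1..<n. a k * cos (real k * t) + b k * sin (real k * t)))"
    using assms unfolding trig_polys_def by blast
  have "Q (\<lambda>t. a 0 / 2 * cos (real 0 * t))" using assms(2) by (intro Qscale Qc) auto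
  then have "Q T" unfolding T by (intro Qadd Qsum) auto
  then show ?thesis by (simp add: Q_def)
qed

lemma trig_polys_borel: "T \<in> trig_polys n \<Longrightarrow> T \<in> borel_measurable borel"
  unfolding trig_polys_def by auto

lemma trig_polys_periodic:
  assumes "T \<in> trig_polys n" "n \<ge> 1" shows "periodic T"
  using assms
proof (induction rule: trig_polys_induct)
  case (cos k)
  have "cos (real k * (t + 2 * pi)) = cos (real k * t + 2 * real k * pi)" for t
    by (simp add: algebra_simps)
  then show ?case by (simp add: periodic_def cos_add)
next
  case (sin k)
  have "sin (real k * (t + 2 * pi)) = sin (real k * t + 2 * real k * pi)" for t
    by (simp add: algebra_simps)
  then show ?case by (simp add: periodic_def sin_add)
qed (auto simp: periodic_def)

lemma trig_polys_bounded:
  assumes "T \<in> trig_polys n" "n \<ge> 1" obtains B where "\<And>t. \<bar>T t\<bar> \<le> B"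
proof -
  have "\<exists>B. \<forall>t. \<bar>T t\<bar> \<le> B" using assms
  proof (induction rule: trig_polys_induct)
    case (cos k) show ?case by (intro exI[of _ 1]) auto
  next
    case (sin k) show ?case by (intro exI[of _ 1]) auto
  next
    case (add S T)
    then obtain B C where "\<And>t. \<bar>S t\<bar> \<le> B" "\<And>t. \<bar>T t\<bar> \<le> C" by blast
    then show ?case by (intro exI[of _ "B + C"]) (meson abs_triangle_ineq add_mono order_trans)
  next
    case (scale S c)
    then obtain B where "\<And>t. \<bar>S t\<bar> \<le> B" by blast
    then show ?case by (intro exI[of _ "\<bar>c\<bar> * B"]) (auto simp: abs_mult mult_left_mono)
  qed
  then show ?thesis using that by blast
qed

text \<open>By the addition formulas; it makes \<open>\<lambda>t. T (x - t)\<close> an admissible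
  test polynomial for every fixed \<open>x\<close>.\<close>

lemma trig_polys_reflect:
  assumes "T \<in> trig_polys n" "n \<ge> 1" shows "(\<lambda>t. T (c - t)) \<in> trig_polys n"
  using assms
proof (induction rule: trig_polys_induct)
  case (cos k)
  have "(\<lambda>t. cos (real k * c) * cos (real k * t) + sin (real k * c) * sin (real k * t)) \<in> trig_polys n"
    using cos by (intro trig_polys_add trig_polys_scale trig_polys_cos trig_polys_sin)
  then show ?case by (simp add: right_diff_distrib cos_diff)
next
  case (sin k)
  have "(\<lambda>t. sin (real k * c) * cos (real k * t) + (- cos (real k * c)) * sin (real k * t)) \<in> trig_polys n"
    using sin by (intro trig_polys_add trig_polys_scale trig_polys_cos trig_polys_sin)
  then show ?case by (simp add: right_diff_distrib sin_diff)
qed (auto intro: trig_polys_add trig_polys_scale)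

lemma integrable_mult_trig_poly:
  assumes "integrable circ g" "T \<in> trig_polys n" "n \<ge> 1"
  shows "integrable circ (\<lambda>t. g t * T t)"
proof -
  obtain B where "\<And>t. \<bar>T t\<bar> \<le> B" using trig_polys_bounded assms by blast
  then show ?thesis using assms
    by (intro integrable_mult_bounded[where B=B]) (auto intro: borel_imp_circ trig_polys_borel)
qed

section \<open>Orthogonality to trigonometric polynomials\<close>

definition orth :: "nat \<Rightarrow> (real \<Rightarrow> real) \<Rightarrow> bool" where
  "orth n g \<longleftrightarrow> (\<forall>T\<in>trig_polys n. (LINT t|circ. g t * T t) = 0)"

lemma orth_iff:
  assumes "integrable circ g" "n \<ge> 1"
  shows "orth n g \<longleftrightarrow> (\<forall>k<n. (LINT t|circ. g t * cos (real k * t)) = 0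
                           \<and> (LINT t|circ. g t * sin (real k * t)) = 0)"
proof safe
  fix k assume "orth n g" "k < n"
  then show "(LINT t|circ. g t * cos (real k * t)) = 0" "(LINT t|circ. g t * sin (real k * t)) = 0"
    unfolding orth_def using trig_polys_cos trig_polys_sin by auto
next
  assume *: "\<forall>k<n. (LINT t|circ. g t * cos (real k * t)) = 0
                           \<and> (LINT t|circ. g t * sin (real k * t)) = 0"
  show "orth n g" unfolding orth_def
  proof
    fix T assume "T \<in> trig_polys n"
    then show "(LINT t|circ. g t * T t) = 0" using assms(2)
    proof (induction rule: trig_polys_induct)
      case (add S T)
      then show ?case using assms
        by (simp add: distrib_left Bochner_Integration.integral_add integrable_mult_trig_poly)
    next
      case (scale S c)
      have "(LINT t|circ. g t * (c * S t)) = (LINT t|circ. c * (g t * S t))" by (simp add: ac_simps)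
      then show ?case using scale by simp
    qed (use * in auto)
  qed
qed

lemma fourier_coeff_eq:
  assumes "integrable circ g"
  shows "fourier_coeff g k = 1 / (2 * of_real pi) *
    Complex (LINT t|circ. g t * cos (of_int k * t)) (- (LINT t|circ. g t * sin (of_int k * t)))"
proof -
  have i: "integrable circ (\<lambda>t. g t * cos (of_int k * t))" "integrable circ (\<lambda>t. g t * sin (of_int k * t))"
    by (intro integrable_mult_bounded[where B=1] assms borel_imp_circ; simp)+
  have e: "of_real (g t) * exp (- \<i> * of_int k * of_real t) =
     complex_of_real (g t * cos (of_int k * t)) - \<i> * complex_of_real (g t * sin (of_int k * t))" for t
  proof -
    have "exp (- \<i> * of_int k * of_real t) = cis (- (of_int k * t))"
      by (simp add: cis_conv_exp mult.assoc)
    then show ?thesis by (simp add: complex_eq_iff)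
  qed
  have "(LINT t|circ. of_real (g t) * exp (- \<i> * of_int k * of_real t)) =
    of_real (LINT t|circ. g t * cos (of_int k * t)) - \<i> * of_real (LINT t|circ. g t * sin (of_int k * t))"
    unfolding e using i
    by (subst Bochner_Integration.integral_diff) (simp_all del: of_real_mult)
  then show ?thesis unfolding fourier_coeff_def by (simp add: complex_eq_iff)
qed

text \<open>For real \<open>g\<close> the coefficients at \<open>k\<close> and \<open>-k\<close> are
  conjugate, so only the cosine and sine moments of order \<open>\<bar>k\<bar>\<close> matter. The
  case \<open>n = 0\<close> is different: \<open>H_ball\<close> then imposes no condition, whereas
  \<open>trig_polys 0\<close> contains the constants.\<close>

lemma orth_iff_fourier_coeff:
  assumes "integrable circ g" "n \<ge> 1"
  shows "orth n g \<longleftrightarrow> (\<forall>k::int. \<bar>k\<bar> \<le> int n - 1 \<longrightarrow> fourier_coeff g k = 0)"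
proof -
  have z: "fourier_coeff g k = 0 \<longleftrightarrow> (LINT t|circ. g t * cos (of_int k * t)) = 0
          \<and> (LINT t|circ. g t * sin (of_int k * t)) = 0" for k
    unfolding fourier_coeff_eq[OF assms(1)] by (auto simp: complex_eq_iff)
  have sym: "fourier_coeff g k = 0 \<longleftrightarrow> (LINT t|circ. g t * cos (real (nat \<bar>k\<bar>) * t)) = 0
          \<and> (LINT t|circ. g t * sin (real (nat \<bar>k\<bar>) * t)) = 0" for k
    unfolding z by (cases "k \<ge> 0") auto
  show ?thesis unfolding orth_iff[OF assms] sym
  proof safe
    fix k :: nat
    assume *: "\<forall>k::int. \<bar>k\<bar> \<le> int n - 1 \<longrightarrow> (LINT t|circ. g t * cos (real (nat \<bar>k\<bar>) * t)) = 0
          \<and> (LINT t|circ. g t * sin (real (nat \<bar>k\<bar>) * t)) = 0" and "k < n"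
    then show "(LINT t|circ. g t * cos (real k * t)) = 0" "(LINT t|circ. g t * sin (real k * t)) = 0"
      using *[rule_format, of "int k"] by auto
  next
    fix k :: int
    assume *: "\<forall>k<n. (LINT t|circ. g t * cos (real k * t)) = 0 \<and> (LINT t|circ. g t * sin (real k * t)) = 0"
      and "\<bar>k\<bar> \<le> int n - 1"
    then have "nat \<bar>k\<bar> < n" by linarith
    then show "(LINT t|circ. g t * cos (real (nat \<bar>k\<bar>) * t)) = 0"
      "(LINT t|circ. g t * sin (real (nat \<bar>k\<bar>) * t)) = 0" using * by auto
  qed
qed

text \<open>Reflection maps the polynomials of bounded degree into themselves. The case of exponent
  \<infinity> reflects both the sign function and the test function.\<close>

lemma orth_reflect:
  assumes "g \<in> borel_measurable borel" "periodic g" "n \<ge> 1" "orth n g"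
  shows "orth n (\<lambda>t. g (- t))"
  unfolding orth_def
proof
  fix T assume T: "T \<in> trig_polys n"
  have "(LINT t|circ. g (0 - t) * T (0 - (0 - t))) = (LINT t|circ. g t * T (0 - t))"
  proof (rule integral_circ_reflect[where f="\<lambda>t. g t * T (0 - t)"])
    show "periodic (\<lambda>t. g t * T (0 - t))"
      using assms(2) trig_polys_periodic[OF trig_polys_reflect[OF T], of 0] assms(3)
      unfolding periodic_def by metis
    show "(\<lambda>t. g t * T (0 - t)) \<in> borel_measurable borel"
      using assms(1) trig_polys_borel[OF T] by measurable
  qed
  also have "\<dots> = 0" using bspec[OF assms(4)[unfolded orth_def] trig_polys_reflect[OF T assms(3), of 0]] by simp
  finally show "(LINT t|circ. g (- t) * T t) = 0" by simp
qed

text \<open>Shifting by \<open>h = pi / m\<close> shows that the vector of the cosine and sine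
  moments of order \<open>k\<close> is fixed by minus the rotation through \<open>k h\<close>. As
  \<open>0 \<le> k h < pi\<close>, this is a rotation through an angle in \<open>[pi, 2 pi)\<close>,
  whose only fixed vector is 0.\<close>

lemma antiperiodic_imp_orth:
  assumes g: "g \<in> borel_measurable borel" "periodic g" "integrable circ g"
    and m: "1 \<le> n" "n \<le> m" and anti: "AE t in circ. g (t + pi / real m) = - g t"
  shows "orth n g"
  unfolding orth_iff[OF g(3) m(1)]
proof (intro allI impI)
  fix k assume k: "k < n"
  define h where "h = pi / real m"
  define A where "A = (LINT t|circ. g t * cos (real k * t))"
  define B where "B = (LINT t|circ. g t * sin (real k * t))"
  define c where "c = cos (real k * h)"
  define s where "s = sin (real k * h)"
  have i: "integrable circ (\<lambda>t. g t * cos (real k * t))" "integrable circ (\<lambda>t. g t * sin (real k * t))"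
    by (intro integrable_mult_bounded[where B=1] g borel_imp_circ; simp)+
  have [measurable]: "g \<in> borel_measurable borel" by (rule g)
  have p: "periodic (\<lambda>t. g t * cos (real k * t))" "periodic (\<lambda>t. g t * sin (real k * t))"
    using g(2) trig_polys_periodic[OF trig_polys_cos[OF k]] trig_polys_periodic[OF trig_polys_sin[OF k]] m
    by (auto simp: periodic_def)
  have "A = (LINT t|circ. g (t + h) * cos (real k * (t + h)))"
    unfolding A_def by (rule integral_circ_shift[symmetric, OF _ p(1)]) measurable
  also have "\<dots> = (LINT t|circ. s * (g t * sin (real k * t)) - c * (g t * cos (real k * t)))"
  proof (rule integral_cong_AE)
    show "AE t in circ. g (t + h) * cos (real k * (t + h)) = s * (g t * sin (real k * t)) - c * (g t * cos (real k * t))"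
      using anti unfolding h_def[symmetric]
      by eventually_elim (auto simp: distrib_left cos_add c_def s_def algebra_simps)
  qed (intro borel_imp_circ; measurable)+
  also have "\<dots> = s * B - c * A" using i by (simp add: A_def B_def)
  finally have 1: "A = s * B - c * A" .
  have "B = (LINT t|circ. g (t + h) * sin (real k * (t + h)))"
    unfolding B_def by (rule integral_circ_shift[symmetric, OF _ p(2)]) measurable
  also have "\<dots> = (LINT t|circ. - c * (g t * sin (real k * t)) - s * (g t * cos (real k * t)))"
  proof (rule integral_cong_AE)
    show "AE t in circ. g (t + h) * sin (real k * (t + h)) = - c * (g t * sin (real k * t)) - s * (g t * cos (real k * t))"
      using anti unfolding h_def[symmetric]
      by eventually_elim (auto simp: distrib_left sin_add c_def s_def algebra_simps)
  qed (intro borel_imp_circ; measurable)+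
  also have "\<dots> = - c * B - s * A" using i by (simp add: A_def B_def)
  finally have 2: "B = - c * B - s * A" .
  have "0 \<le> real k * h" "real k * h < pi"
    using k m by (auto simp: h_def field_simps)
  then have "c > -1" unfolding c_def using cos_monotone_0_pi[of "real k * h" pi] by simp
  \<comment> \<open>This is the determinant of the homogeneous linear system that facts 1 and 2 form
    in \<open>A\<close> and \<open>B\<close>. On \<open>[0, pi]\<close> it vanishes only at the
    angle \<open>pi\<close>, which \<open>k < n \<le> m\<close> excludes.\<close>
  then have pos: "(1 + c)\<^sup>2 + s\<^sup>2 > 0" by (intro add_pos_nonneg) (auto simp: power2_eq_square)
  have "((1 + c)\<^sup>2 + s\<^sup>2) * A = 0" "((1 + c)\<^sup>2 + s\<^sup>2) * B = 0"
    using 1 2 by algebra+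
  then have "A = 0" "B = 0" using pos by auto
  then show "(LINT t|circ. g t * cos (real k * t)) = 0 \<and> (LINT t|circ. g t * sin (real k * t)) = 0"
    by (simp add: A_def B_def)
qed

section \<open>Convolution\<close>

definition conv :: "(real \<Rightarrow> real) \<Rightarrow> (real \<Rightarrow> real) \<Rightarrow> real \<Rightarrow> real" where
  "conv \<phi> K x = 1 / (2 * pi) * (LINT t|circ. \<phi> (x - t) * K t)"

lemma sigma_finite_circ: "sigma_finite_measure circ"
  using finite_measure_circ by (simp add: finite_measure_def)

lemma pair_sigma_finite_circ: "pair_sigma_finite circ circ"
  by (simp add: pair_sigma_finite_def sigma_finite_circ)

lemma conv_measurable:
  assumes [measurable]: "\<phi> \<in> borel_measurable borel" "K \<in> borel_measurable borel"
  shows "conv \<phi> K \<in> borel_measurable circ"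
proof -
  have "(\<lambda>(x, t). \<phi> (x - t) * K t) \<in> borel_measurable (circ \<Otimes>\<^sub>M circ)"
    by (rule borel_imp_circ_pair) measurable
  from sigma_finite_measure.borel_measurable_lebesgue_integral[OF sigma_finite_circ this]
  show ?thesis unfolding conv_def[abs_def] by simp
qed

text \<open>The substitution \<open>t \<mapsto> x - t\<close> moves the reflected argument onto the
  second factor; for a polynomial \<open>T\<close> the convolution becomes the pairing of
  \<open>\<phi>\<close> with \<open>\<lambda>t. T (x - t)\<close>.\<close>

lemma conv_eq_reflected:
  assumes "\<phi> \<in> borel_measurable borel" "periodic \<phi>" "K \<in> borel_measurable borel" "periodic K"
  shows "conv \<phi> K x = 1 / (2 * pi) * (LINT t|circ. \<phi> t * K (x - t))"
proof -
  have "(LINT t|circ. \<phi> (x - t) * K (x - (x - t))) = (LINT t|circ. \<phi> t * K (x - t))"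
  proof (rule integral_circ_reflect[where f="\<lambda>t. \<phi> t * K (x - t)"])
    show "periodic (\<lambda>t. \<phi> t * K (x - t))"
      using assms(2) periodic_reflect[OF assms(4), of x] unfolding periodic_def by metis
    show "(\<lambda>t. \<phi> t * K (x - t)) \<in> borel_measurable borel" using assms(1,3) by measurable
  qed
  then show ?thesis by (simp add: conv_def)
qed

lemma conv_trig_poly_eq_0:
  assumes "\<phi> \<in> borel_measurable borel" "periodic \<phi>" "orth n \<phi>" "T \<in> trig_polys n" "n \<ge> 1"
  shows "conv \<phi> T x = 0"
proof -
  have "(LINT t|circ. \<phi> t * T (x - t)) = 0"
    using bspec[OF assms(3)[unfolded orth_def] trig_polys_reflect[OF assms(4,5), of x]] by simp
  then show ?thesis
    using assms by (simp add: conv_eq_reflected trig_polys_borel trig_polys_periodic)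
qed

text \<open>The addition formulas separate \<open>x\<close> from \<open>t\<close> in the cosine and
  sine of \<open>k (x - t)\<close>; the coefficients that remain are the moments \<open>A\<close>
  and \<open>B\<close> of \<open>\<phi>\<close>.\<close>

lemma conv_trig_poly:
  assumes \<phi>: "\<phi> \<in> borel_measurable borel" "periodic \<phi>" "integrable circ \<phi>"
    and "T \<in> trig_polys n" "n \<ge> 1"
  shows "conv \<phi> T \<in> trig_polys n"
  using assms(4,5)
proof (induction rule: trig_polys_induct)
  have i: "integrable circ (\<lambda>t. \<phi> t * cos (real k * t))" "integrable circ (\<lambda>t. \<phi> t * sin (real k * t))" for k
    by (intro integrable_mult_bounded[where B=1] \<phi> borel_imp_circ; simp)+
  {
    fix k assume k: "k < n"
    have pc: "periodic (\<lambda>t. cos (real k * t))" "periodic (\<lambda>t. sin (real k * t))"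
      using trig_polys_periodic[OF trig_polys_cos[OF k] assms(5)] trig_polys_periodic[OF trig_polys_sin[OF k] assms(5)] .
    define A where "A = (LINT t|circ. \<phi> t * cos (real k * t))"
    define B where "B = (LINT t|circ. \<phi> t * sin (real k * t))"
    have "(LINT t|circ. \<phi> t * cos (real k * (x - t)))
        = (LINT t|circ. cos (real k * x) * (\<phi> t * cos (real k * t)) + sin (real k * x) * (\<phi> t * sin (real k * t)))" for x
      by (simp add: right_diff_distrib cos_diff algebra_simps)
    also have "\<dots> x = cos (real k * x) * A + sin (real k * x) * B" for x
      using i by (simp add: A_def B_def)
    finally have "conv \<phi> (\<lambda>t. cos (real k * t)) = (\<lambda>x. 1 / (2 * pi) * A * cos (real k * x) + 1 / (2 * pi) * B * sin (real k * x))"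
      by (intro ext, subst conv_eq_reflected[OF \<phi>(1,2) _ pc(1)]) (simp_all add: field_simps)
    then show "conv \<phi> (\<lambda>t. cos (real k * t)) \<in> trig_polys n"
      using k by (simp only:) (intro trig_polys_add trig_polys_scale trig_polys_cos trig_polys_sin)
    have "(LINT t|circ. \<phi> t * sin (real k * (x - t)))
        = (LINT t|circ. sin (real k * x) * (\<phi> t * cos (real k * t)) - cos (real k * x) * (\<phi> t * sin (real k * t)))" for x
      by (simp add: right_diff_distrib sin_diff algebra_simps)
    also have "\<dots> x = sin (real k * x) * A - cos (real k * x) * B" for x
      using i by (simp add: A_def B_def)
    finally have "conv \<phi> (\<lambda>t. sin (real k * t)) = (\<lambda>x. 1 / (2 * pi) * A * sin (real k * x) - 1 / (2 * pi) * B * cos (real k * x))"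
      by (intro ext, subst conv_eq_reflected[OF \<phi>(1,2) _ pc(2)]) (simp_all add: field_simps)
    then show "conv \<phi> (\<lambda>t. sin (real k * t)) \<in> trig_polys n"
      using k by (simp only:) (intro trig_polys_diff trig_polys_scale trig_polys_cos trig_polys_sin)
  next
    fix S T assume *: "S \<in> trig_polys n" "T \<in> trig_polys n" "conv \<phi> S \<in> trig_polys n" "conv \<phi> T \<in> trig_polys n"
    have "integrable circ (\<lambda>t. \<phi> (x - t) * R t)" if "R \<in> trig_polys n" for x R
      using that assms(5) \<phi> by (intro integrable_mult_trig_poly) (auto simp: integrable_circ_reflect)
    then have "conv \<phi> (\<lambda>t. S t + T t) = (\<lambda>x. conv \<phi> S x + conv \<phi> T x)"
      using * by (auto simp: conv_def distrib_left)
    then show "conv \<phi> (\<lambda>t. S t + T t) \<in> trig_polys n" using * by (simp add: trig_polys_add)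
  next
    fix S c assume *: "S \<in> trig_polys n" "conv \<phi> S \<in> trig_polys n"
    have "conv \<phi> (\<lambda>t. c * S t) = (\<lambda>x. c * conv \<phi> S x)"
      by (auto simp: conv_def mult.left_commute[of _ c])
    then show "conv \<phi> (\<lambda>t. c * S t) \<in> trig_polys n" using * by (simp add: trig_polys_scale)
  }
qed

text \<open>Tonelli, then shift invariance of the inner integral. It serves twice: its finiteness
  makes the convolution converge almost everywhere, and its value bounds the L_1 norm.\<close>

lemma nn_integral_conv_abs:
  assumes \<phi> [measurable]: "\<phi> \<in> borel_measurable borel" and p: "periodic \<phi>"
    and R [measurable]: "R \<in> borel_measurable borel"
  shows "(\<integral>\<^sup>+x. \<integral>\<^sup>+t. ennreal \<bar>\<phi> (x - t) * R t\<bar> \<partial>circ \<partial>circ) = Lp_norm 1 \<phi> * Lp_norm 1 R"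
proof -
  have m: "(\<lambda>(x, t). ennreal \<bar>\<phi> (x - t) * R t\<bar>) \<in> borel_measurable (circ \<Otimes>\<^sub>M circ)"
    by (rule borel_imp_circ_pair) measurable
  have mc: "(\<lambda>x. ennreal \<bar>\<phi> (x - t)\<bar>) \<in> borel_measurable circ" "(\<lambda>x. ennreal \<bar>R x\<bar>) \<in> borel_measurable circ" for t
    by (auto intro!: borel_imp_circ)
  have "(\<integral>\<^sup>+x. \<integral>\<^sup>+t. ennreal \<bar>\<phi> (x - t) * R t\<bar> \<partial>circ \<partial>circ)
      = (\<integral>\<^sup>+t. \<integral>\<^sup>+x. ennreal \<bar>\<phi> (x - t) * R t\<bar> \<partial>circ \<partial>circ)"
    using pair_sigma_finite.Fubini'[OF pair_sigma_finite_circ m] by simp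
  also have "\<dots> = (\<integral>\<^sup>+t. (\<integral>\<^sup>+x. ennreal \<bar>\<phi> (x + - t)\<bar> \<partial>circ) * ennreal \<bar>R t\<bar> \<partial>circ)"
    using mc by (simp add: abs_mult ennreal_mult nn_integral_multc)
  also have "\<dots> = (\<integral>\<^sup>+t. Lp_norm 1 \<phi> * ennreal \<bar>R t\<bar> \<partial>circ)"
  proof (rule nn_integral_cong)
    fix t
    show "(\<integral>\<^sup>+x. ennreal \<bar>\<phi> (x + - t)\<bar> \<partial>circ) * ennreal \<bar>R t\<bar> = Lp_norm 1 \<phi> * ennreal \<bar>R t\<bar>"
      using nn_integral_circ_shift[of "\<lambda>x. ennreal \<bar>\<phi> x\<bar>" "- t"] p by (simp add: Lp_norm_1 periodic_def)
  qed
  also have "\<dots> = Lp_norm 1 \<phi> * Lp_norm 1 R"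
    using mc by (simp add: nn_integral_cmult Lp_norm_1)
  finally show ?thesis .
qed

lemma integrable_iff_Lp_norm_1:
  assumes "f \<in> borel_measurable circ"
  shows "integrable circ f \<longleftrightarrow> Lp_norm 1 f < \<infinity>"
  using assms by (auto simp: integrable_iff_bounded Lp_norm_1)

text \<open>A nonnegative function with finite integral, here the inner integral of absolute values,
  is finite almost everywhere. At such points the convolution is additive in the kernel.\<close>

lemma AE_integrable_conv:
  fixes \<phi> R :: "real \<Rightarrow> real"
  assumes \<phi> [measurable]: "\<phi> \<in> borel_measurable borel" and p: "periodic \<phi>" and i: "integrable circ \<phi>"
    and R [measurable]: "R \<in> borel_measurable borel" and iR: "integrable circ R"
  shows "AE x in circ. integrable circ (\<lambda>t. \<phi> (x - t) * R t)"
proof -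
  have mR: "(\<lambda>(x, t). ennreal \<bar>\<phi> (x - t) * R t\<bar>) \<in> borel_measurable (circ \<Otimes>\<^sub>M circ)"
    by (rule borel_imp_circ_pair) measurable
  have fin: "(\<integral>\<^sup>+x. \<integral>\<^sup>+t. ennreal \<bar>\<phi> (x - t) * R t\<bar> \<partial>circ \<partial>circ) < \<infinity>"
    using i iR unfolding nn_integral_conv_abs[OF \<phi> p R]
    by (simp add: integrable_iff_Lp_norm_1 borel_imp_circ ennreal_mult_less_top)
  have "AE x in circ. (\<integral>\<^sup>+t. ennreal \<bar>\<phi> (x - t) * R t\<bar> \<partial>circ) \<noteq> \<infinity>"
    using fin sigma_finite_measure.borel_measurable_nn_integral[OF sigma_finite_circ mR]
    by (intro nn_integral_PInf_AE) auto
  then show ?thesis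
  proof eventually_elim
    case (elim x)
    have "(\<lambda>t. \<phi> (x - t) * R t) \<in> borel_measurable circ" by (rule borel_imp_circ) measurable
    then show ?case using elim by (simp add: integrable_iff_Lp_norm_1 Lp_norm_1 less_top)
  qed
qed

lemma conv_diff:
  fixes \<phi> K T :: "real \<Rightarrow> real"
  assumes "integrable circ (\<lambda>t. \<phi> (x - t) * K t)" "integrable circ (\<lambda>t. \<phi> (x - t) * T t)"
  shows "conv \<phi> (\<lambda>t. K t - T t) x = conv \<phi> K x - conv \<phi> T x"
  using assms by (simp add: conv_def right_diff_distrib)

lemma Lp_norm_1_conv_le:
  assumes [measurable]: "\<phi> \<in> borel_measurable borel" and "periodic \<phi>"
    and [measurable]: "R \<in> borel_measurable borel"
  shows "Lp_norm 1 (conv \<phi> R) \<le> ennreal (1 / (2 * pi)) * (Lp_norm 1 \<phi> * Lp_norm 1 R)"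
proof -
  have m: "(\<lambda>(x, t). ennreal \<bar>\<phi> (x - t) * R t\<bar>) \<in> borel_measurable (circ \<Otimes>\<^sub>M circ)"
    by (rule borel_imp_circ_pair) measurable
  have "ennreal \<bar>conv \<phi> R x\<bar> \<le> ennreal (1 / (2 * pi)) * (\<integral>\<^sup>+t. ennreal \<bar>\<phi> (x - t) * R t\<bar> \<partial>circ)" for x
  proof -
    \<comment> \<open>Where the integral diverges its default value is 0, so the bound holds at
      every \<open>x\<close>.\<close>
    have "ennreal \<bar>LINT t|circ. \<phi> (x - t) * R t\<bar> \<le> (\<integral>\<^sup>+t. ennreal \<bar>\<phi> (x - t) * R t\<bar> \<partial>circ)"
      using integral_norm_bound_ennreal[of circ "\<lambda>t. \<phi> (x - t) * R t"]
      by (cases "integrable circ (\<lambda>t. \<phi> (x - t) * R t)") (auto simp: not_integrable_integral_eq)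
    moreover have "ennreal \<bar>conv \<phi> R x\<bar> = ennreal (1 / (2 * pi)) * ennreal \<bar>LINT t|circ. \<phi> (x - t) * R t\<bar>"
      by (subst ennreal_mult[symmetric]) (auto simp: conv_def abs_mult)
    ultimately show ?thesis by (simp only: mult_left_mono zero_le)
  qed
  then have "Lp_norm 1 (conv \<phi> R) \<le> (\<integral>\<^sup>+x. ennreal (1 / (2 * pi)) * (\<integral>\<^sup>+t. ennreal \<bar>\<phi> (x - t) * R t\<bar> \<partial>circ) \<partial>circ)"
    unfolding Lp_norm_1 by (intro nn_integral_mono)
  also have "\<dots> = ennreal (1 / (2 * pi)) * (\<integral>\<^sup>+x. (\<integral>\<^sup>+t. ennreal \<bar>\<phi> (x - t) * R t\<bar> \<partial>circ) \<partial>circ)"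
    using sigma_finite_measure.borel_measurable_nn_integral[OF sigma_finite_circ m]
    by (intro nn_integral_cmult) simp
  finally show ?thesis using nn_integral_conv_abs[OF assms] by simp
qed

text \<open>The bound on \<open>\<phi>\<close> survives the substitution
  \<open>t \<mapsto> x - t\<close> for each fixed \<open>x\<close>, so here convergence and estimate
  hold at every point and not only almost everywhere.\<close>

lemma
  assumes \<phi> [measurable]: "\<phi> \<in> borel_measurable borel" and p: "periodic \<phi>" and b: "AE t in circ. \<bar>\<phi> t\<bar> \<le> 1"
    and R: "integrable circ R"
  shows integrable_conv_bounded: "integrable circ (\<lambda>t. \<phi> (x - t) * R t)"
    and abs_conv_bounded_le: "\<bar>conv \<phi> R x\<bar> \<le> 1 / (2 * pi) * (LINT t|circ. \<bar>R t\<bar>)"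
proof -
  have b': "AE t in circ. \<bar>\<phi> (x - t)\<bar> \<le> 1"
    using p by (intro AE_circ_reflect[OF _ _ b]) (auto simp: periodic_def)
  show i: "integrable circ (\<lambda>t. \<phi> (x - t) * R t)"
    using integrable_mult_bounded[OF R _ b'] by (simp add: borel_imp_circ mult.commute)
  have "\<bar>LINT t|circ. \<phi> (x - t) * R t\<bar> \<le> (LINT t|circ. \<bar>\<phi> (x - t) * R t\<bar>)"
    by (rule integral_abs_bound)
  also have "\<dots> \<le> (LINT t|circ. \<bar>R t\<bar>)"
  proof (rule integral_mono_AE)
    show "AE t in circ. \<bar>\<phi> (x - t) * R t\<bar> \<le> \<bar>R t\<bar>"
      using b' by eventually_elim (simp add: abs_mult mult_left_le_one_le)
  qed (use i R in auto)
  finally show "\<bar>conv \<phi> R x\<bar> \<le> 1 / (2 * pi) * (LINT t|circ. \<bar>R t\<bar>)"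
    by (simp add: conv_def abs_mult divide_right_mono)
qed

lemma Lp_norm_1_eq_integral: "integrable circ f \<Longrightarrow> Lp_norm 1 f = ennreal (LINT t|circ. \<bar>f t\<bar>)"
  unfolding Lp_norm_1 by (intro nn_integral_eq_integral) auto

lemma AE_le_of_Lp_norm_infinity:
  assumes "Lp_norm \<infinity> f \<le> ennreal c" "c \<ge> 0"
  shows "AE t in circ. \<bar>f t\<bar> \<le> c"
  using esssup_AE[of "\<lambda>t. ennreal \<bar>f t\<bar>" circ]
proof eventually_elim
  case (elim t)
  then have "ennreal \<bar>f t\<bar> \<le> ennreal c" using assms(1) unfolding Lp_norm_infinity by (rule order_trans)
  then show ?case using assms(2) by simp
qed

text \<open>The spectral condition becomes orthogonality. Integrability follows from the norm bound,
  for exponent \<infinity> because \<open>circ\<close> has finite measure, and is listed for later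
  use. Degree 0 is a separate clause because its spectral condition is void.\<close>

lemma H_ball_borel_iff:
  assumes \<phi> [measurable]: "\<phi> \<in> borel_measurable borel" and p: "p = 1 \<or> p = \<infinity>" and n: "n \<ge> 1"
  shows "\<phi> \<in> H_ball p n \<longleftrightarrow> periodic \<phi> \<and> integrable circ \<phi> \<and> Lp_norm p \<phi> \<le> 1 \<and> orth n \<phi>"
    and "\<phi> \<in> H_ball p 0 \<longleftrightarrow> periodic \<phi> \<and> integrable circ \<phi> \<and> Lp_norm p \<phi> \<le> 1"
proof -
  have l: "\<phi> \<in> borel_measurable lebesgue" by (rule measurable_completion) simp
  have m: "\<phi> \<in> borel_measurable circ" by (rule borel_imp_circ) simp
  have fin: "Lp_norm p \<phi> < \<infinity>" if "Lp_norm p \<phi> \<le> 1"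
    using that by (simp add: le_less_trans)
  have i: "integrable circ \<phi>" if "Lp_norm p \<phi> \<le> 1"
  proof (cases "p = 1")
    case True
    then show ?thesis using fin[OF that] m by (simp add: integrable_iff_Lp_norm_1)
  next
    case False
    then have "p = \<infinity>" using p by simp
    then have "AE t in circ. \<bar>\<phi> t\<bar> \<le> 1"
      using AE_le_of_Lp_norm_infinity[of \<phi> 1] that by simp
    then show ?thesis
      using finite_measure.integrable_const_bound[OF finite_measure_circ, of \<phi> 1] m by simp
  qed
  show "\<phi> \<in> H_ball p n \<longleftrightarrow> periodic \<phi> \<and> integrable circ \<phi> \<and> Lp_norm p \<phi> \<le> 1 \<and> orth n \<phi>"
    unfolding H_ball_def Lp_def periodic_def using i fin l orth_iff_fourier_coeff[OF _ n, of \<phi>] by auto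
  show "\<phi> \<in> H_ball p 0 \<longleftrightarrow> periodic \<phi> \<and> integrable circ \<phi> \<and> Lp_norm p \<phi> \<le> 1"
    unfolding H_ball_def Lp_def periodic_def using i fin l by auto
qed

text \<open>Young's inequality for \<open>K - T\<close>. The two convolutions are kept apart because
  \<open>conv \<phi> T\<close> is to be the approximating polynomial; merging them is legitimate
  almost everywhere for exponent 1 and everywhere for exponent \<infinity>.\<close>

lemma Lp_norm_conv_diff_le:
  assumes p: "p = 1 \<or> p = \<infinity>"
    and \<phi> [measurable]: "\<phi> \<in> borel_measurable borel" and per: "periodic \<phi>" and i: "integrable circ \<phi>"
    and norm: "Lp_norm p \<phi> \<le> 1"
    and K [measurable]: "K \<in> borel_measurable borel" and iK: "integrable circ K"
    and T: "T \<in> trig_polys n" "n \<ge> 1"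
  shows "Lp_norm p (\<lambda>x. conv \<phi> K x - conv \<phi> T x) \<le> ennreal (1 / (2 * pi)) * Lp_norm 1 (\<lambda>t. K t - T t)"
proof -
  have [measurable]: "T \<in> borel_measurable borel" using T by (simp add: trig_polys_borel)
  obtain B where "\<And>t. \<bar>T t\<bar> \<le> B" using trig_polys_bounded T by blast
  then have iT: "integrable circ T"
    using finite_measure.integrable_const_bound[OF finite_measure_circ, of T B] by (simp add: borel_imp_circ)
  show ?thesis
  proof (cases "p = 1")
    case True
    have "AE x in circ. conv \<phi> (\<lambda>t. K t - T t) x = conv \<phi> K x - conv \<phi> T x"
      using AE_integrable_conv[OF \<phi> per i K iK] AE_integrable_conv[OF \<phi> per i \<open>T \<in> borel_measurable borel\<close> iT]
      by eventually_elim (rule conv_diff)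
    then have "Lp_norm 1 (\<lambda>x. conv \<phi> K x - conv \<phi> T x) = Lp_norm 1 (conv \<phi> (\<lambda>t. K t - T t))"
      unfolding Lp_norm_1 by (intro nn_integral_cong_AE) (auto elim!: eventually_mono)
    also have "\<dots> \<le> ennreal (1 / (2 * pi)) * (Lp_norm 1 \<phi> * Lp_norm 1 (\<lambda>t. K t - T t))"
      using per by (intro Lp_norm_1_conv_le) auto
    also have "\<dots> \<le> ennreal (1 / (2 * pi)) * (1 * Lp_norm 1 (\<lambda>t. K t - T t))"
      using norm True by (intro mult_left_mono mult_right_mono) auto
    finally show ?thesis using True by simp
  next
    case False
    then have p: "p = \<infinity>" using p by simp
    then have b: "AE t in circ. \<bar>\<phi> t\<bar> \<le> 1"
      using AE_le_of_Lp_norm_infinity[of \<phi> 1] norm by simp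
    have "conv \<phi> K x - conv \<phi> T x = conv \<phi> (\<lambda>t. K t - T t) x" for x
      using integrable_conv_bounded[OF \<phi> per b] iK iT by (simp add: conv_diff)
    then have le: "\<bar>conv \<phi> K x - conv \<phi> T x\<bar> \<le> 1 / (2 * pi) * (LINT t|circ. \<bar>K t - T t\<bar>)" for x
      using abs_conv_bounded_le[OF \<phi> per b, of "\<lambda>t. K t - T t"] iK iT by simp
    have "conv \<phi> K \<in> borel_measurable circ" "conv \<phi> T \<in> borel_measurable circ"
      by (auto intro!: conv_measurable)
    then have "Lp_norm \<infinity> (\<lambda>x. conv \<phi> K x - conv \<phi> T x) \<le> ennreal (1 / (2 * pi) * (LINT t|circ. \<bar>K t - T t\<bar>))"
      unfolding Lp_norm_infinity using le by (intro esssup_I AE_I2 ennreal_leI) auto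
    also have "\<dots> = ennreal (1 / (2 * pi)) * Lp_norm 1 (\<lambda>t. K t - T t)"
      using iK iT by (subst ennreal_mult) (auto simp: Lp_norm_1_eq_integral)
    finally show ?thesis using p by simp
  qed
qed

section \<open>Concentrated antiperiodic test functions\<close>

lemma integral_circ_eq_lborel:
  fixes f :: "real \<Rightarrow> real"
  assumes [measurable]: "f \<in> borel_measurable borel"
  shows "(LINT t|circ. f t) = (LINT t|lborel. indicator {-pi..pi} t * f t)"
  by (simp add: integral_restrict_space integral_completion)

lemma integrable_circ_bounded:
  fixes f :: "real \<Rightarrow> real"
  assumes "f \<in> borel_measurable borel" "\<And>x. \<bar>f x\<bar> \<le> B"
  shows "integrable circ f"
proof (rule finite_measure.integrable_const_bound[OF finite_measure_circ])
  show "AE x in circ. norm (f x) \<le> B" using assms(2) by (intro AE_I2) simp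
  show "f \<in> borel_measurable circ" by (rule borel_imp_circ) fact
qed

text \<open>Truncating \<open>K\<close> at a large height \<open>C\<close> changes little in L_1, by
  domination by \<open>\<bar>K\<bar>\<close>. A measurable function is an almost everywhere limit of
  continuous ones, and clipping these at the same height provides the majorant \<open>2 * C\<close>
  for a second limit passage.\<close>

lemma L1_approx_continuous:
  fixes K :: "real \<Rightarrow> real"
  assumes [measurable]: "K \<in> borel_measurable borel" and i: "integrable circ K" and e: "e > 0"
  obtains g B where "continuous_on UNIV g" "\<And>x. \<bar>g x\<bar> \<le> B" "(LINT t|circ. \<bar>K t - g t\<bar>) < e"
proof -
  have "K \<in> borel_measurable lebesgue" by (rule measurable_completion) simp
  then have "K measurable_on UNIV" by (rule lebesgue_measurable_imp_measurable_on) simp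
  then obtain N g where N: "negligible N" and g: "\<And>n. continuous_on UNIV (g n)"
    and lim: "\<And>x. x \<notin> N \<Longrightarrow> (\<lambda>n. g n x) \<longlonglongrightarrow> K x"
    unfolding measurable_on_def by auto
  have gb [measurable]: "g n \<in> borel_measurable borel" for n
    using g by (rule borel_measurable_continuous_onI)
  define cl where "cl C y = max (- C) (min C y)" for C y :: real
  have [measurable]: "cl C \<in> borel_measurable borel" for C unfolding cl_def by measurable
  have aeN: "AE x in circ. x \<notin> N"
    using N by (intro AE_lebesgue_imp_circ AE_not_in) (simp add: negligible_iff_null_sets)
  have mb: "f \<in> borel_measurable circ" if "f \<in> borel_measurable borel" for f :: "real \<Rightarrow> real"
    using that by (rule borel_imp_circ)
  have "(\<lambda>n. LINT t|circ. \<bar>K t - cl (real n) (K t)\<bar>) \<longlonglongrightarrow> (LINT t|circ. 0)"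
  proof (rule integral_dominated_convergence[where w="\<lambda>t. \<bar>K t\<bar>"])
    show "AE x in circ. (\<lambda>n. \<bar>K x - cl (real n) (K x)\<bar>) \<longlonglongrightarrow> 0"
    proof (intro AE_I2 tendsto_eventually)
      fix x
      show "\<forall>\<^sub>F n in sequentially. \<bar>K x - cl (real n) (K x)\<bar> = 0"
        using eventually_ge_at_top[of "nat \<lceil>\<bar>K x\<bar>\<rceil>"]
      proof eventually_elim
        case (elim n)
        then have "\<bar>K x\<bar> \<le> real n" by linarith
        then show ?case by (auto simp: cl_def max_def min_def)
      qed
    qed
    show "AE x in circ. norm \<bar>K x - cl (real n) (K x)\<bar> \<le> \<bar>K x\<bar>" for n
      by (intro AE_I2) (auto simp: cl_def max_def min_def)
  qed (use i in \<open>auto intro!: mb\<close>)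
  then have "\<forall>\<^sub>F n in sequentially. (LINT t|circ. \<bar>K t - cl (real n) (K t)\<bar>) < e / 2"
    by (rule order_tendstoD(2)) (use e in simp)
  then obtain n where n: "(LINT t|circ. \<bar>K t - cl (real n) (K t)\<bar>) < e / 2"
    using eventually_happens by fastforce
  define C where "C = real n"
  have clC: "\<bar>cl C y\<bar> \<le> C" for y by (auto simp: C_def cl_def)
  have "(\<lambda>k. LINT t|circ. \<bar>cl C (K t) - cl C (g k t)\<bar>) \<longlonglongrightarrow> (LINT t|circ. 0)"
  proof (rule integral_dominated_convergence[where w="\<lambda>t. 2 * C"])
    show "AE x in circ. (\<lambda>k. \<bar>cl C (K x) - cl C (g k x)\<bar>) \<longlonglongrightarrow> 0"
      using aeN
    proof eventually_elim
      case (elim x)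
      have "(\<lambda>k. \<bar>cl C (K x) - cl C (g k x)\<bar>) \<longlonglongrightarrow> \<bar>cl C (K x) - cl C (K x)\<bar>"
        unfolding cl_def by (intro tendsto_intros lim elim)
      then show ?case by simp
    qed
    show "AE x in circ. norm \<bar>cl C (K x) - cl C (g k x)\<bar> \<le> 2 * C" for k
    proof (rule AE_I2)
      fix x
      show "norm \<bar>cl C (K x) - cl C (g k x)\<bar> \<le> 2 * C" using clC[of "K x"] clC[of "g k x"] by simp
    qed
    show "integrable circ (\<lambda>t. 2 * C)" by (rule integrable_circ_bounded[where B="\<bar>2 * C\<bar>"]) auto
  qed (auto intro!: mb)
  then have "\<forall>\<^sub>F k in sequentially. (LINT t|circ. \<bar>cl C (K t) - cl C (g k t)\<bar>) < e / 2"
    by (rule order_tendstoD(2)) (use e in simp)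
  then obtain k where k: "(LINT t|circ. \<bar>cl C (K t) - cl C (g k t)\<bar>) < e / 2"
    using eventually_happens by fastforce
  have ic: "integrable circ (\<lambda>t. cl C (K t))" "integrable circ (\<lambda>t. cl C (g k t))"
    by (rule integrable_circ_bounded[where B=C]; use clC in measurable)+
  show thesis
  proof (rule that[of "\<lambda>t. cl C (g k t)" C])
    show "continuous_on UNIV (\<lambda>t. cl C (g k t))"
      unfolding cl_def by (intro continuous_intros g)
    show "\<bar>cl C (g k x)\<bar> \<le> C" for x by (rule clC)
    have "(LINT t|circ. \<bar>K t - cl C (g k t)\<bar>) \<le> (LINT t|circ. \<bar>K t - cl C (K t)\<bar> + \<bar>cl C (K t) - cl C (g k t)\<bar>)"
      using i ic by (intro integral_mono) auto
    also have "\<dots> = (LINT t|circ. \<bar>K t - cl C (K t)\<bar>) + (LINT t|circ. \<bar>cl C (K t) - cl C (g k t)\<bar>)"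
      using i ic by (intro Bochner_Integration.integral_add) auto
    also have "\<dots> < e" using n k by (simp add: C_def)
    finally show "(LINT t|circ. \<bar>K t - cl C (g k t)\<bar>) < e" .
  qed
qed

section \<open>The correlation \<open>corr K \<psi>\<close>, the function G of the overview\<close>

definition corr :: "(real \<Rightarrow> real) \<Rightarrow> (real \<Rightarrow> real) \<Rightarrow> real \<Rightarrow> real" where
  "corr K \<psi> u = (LINT t|circ. K t * \<psi> (u + t))"

lemma integrable_corr:
  fixes K \<psi> :: "real \<Rightarrow> real"
  assumes \<psi> [measurable]: "\<psi> \<in> borel_measurable borel" and b: "\<And>t. \<bar>\<psi> t\<bar> \<le> 1" and K: "integrable circ K"
  shows "integrable circ (\<lambda>t. K t * \<psi> (u + t))"
  by (rule integrable_mult_bounded[where B=1, OF K]) (auto intro!: borel_imp_circ b)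

lemma abs_corr_le:
  assumes \<psi> [measurable]: "\<psi> \<in> borel_measurable borel" and b: "\<And>t. \<bar>\<psi> t\<bar> \<le> 1" and K: "integrable circ K"
  shows "\<bar>corr K \<psi> u\<bar> \<le> (LINT t|circ. \<bar>K t\<bar>)"
proof -
  have "\<bar>corr K \<psi> u\<bar> \<le> (LINT t|circ. \<bar>K t * \<psi> (u + t)\<bar>)"
    unfolding corr_def by (rule integral_abs_bound)
  also have "\<dots> \<le> (LINT t|circ. \<bar>K t\<bar>)"
  proof (rule integral_mono)
    show "integrable circ (\<lambda>t. \<bar>K t * \<psi> (u + t)\<bar>)"
      using integrable_corr[OF assms] by (rule integrable_abs)
  qed (use K b in \<open>auto simp: abs_mult mult_right_le_one_le\<close>)
  finally show ?thesis .
qed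

text \<open>The substitution \<open>s = u + t\<close> takes the parameter off the merely measurable
  \<open>\<psi>\<close> and puts it on the continuous \<open>g\<close>. As \<open>g\<close> need not
  be periodic, the window of integration moves as well and its indicator becomes part of the
  integrand.\<close>

lemma corr_continuous_lim:
  assumes \<psi> [measurable]: "\<psi> \<in> borel_measurable borel" and b: "\<And>t. \<bar>\<psi> t\<bar> \<le> 1"
    and g: "continuous_on UNIV g" and B: "\<And>x. \<bar>g x\<bar> \<le> B" and u: "u \<longlonglongrightarrow> (0::real)"
  shows "(\<lambda>n. corr g \<psi> (u n)) \<longlonglongrightarrow> corr g \<psi> 0"
proof -
  have [measurable]: "g \<in> borel_measurable borel" using g by (rule borel_measurable_continuous_onI)
  define I where "I = (indicator {-pi..pi} :: real \<Rightarrow> real)"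
  have [measurable]: "I \<in> borel_measurable borel" unfolding I_def by measurable
  define F where "F v s = I (s - v) * (g (s - v) * \<psi> s)" for v s
  have eq: "corr g \<psi> v = (LINT s|lborel. F v s)" for v
  proof -
    have "(LINT s|lborel. F v s) = (LINT s|lborel. F v (v + 1 * s))"
      by (subst lborel_integral_real_affine[where c=1 and t=v]) auto
    also have "\<dots> = corr g \<psi> v"
      unfolding corr_def by (subst integral_circ_eq_lborel) (auto simp: F_def I_def)
    finally show ?thesis ..
  qed
  \<comment> \<open>With shifts below 1 all moved windows lie in \<open>[-pi - 1, pi + 1]\<close>,
    where the constant \<open>B\<close> dominates.\<close>
  obtain n0 where n0: "\<And>n. n \<ge> n0 \<Longrightarrow> \<bar>u n\<bar> < 1"
    using LIMSEQ_D[OF u, of 1] by auto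
  have "(\<lambda>n. LINT s|lborel. F (u (n + n0)) s) \<longlonglongrightarrow> (LINT s|lborel. F 0 s)"
  proof (rule integral_dominated_convergence[where w="\<lambda>s. B * indicator {-pi - 1..pi + 1} s"])
    show "AE s in lborel. (\<lambda>n. F (u (n + n0)) s) \<longlonglongrightarrow> F 0 s"
      using AE_lborel_singleton[of pi] AE_lborel_singleton[of "-pi"]
    proof eventually_elim
      case (elim s)
      \<comment> \<open>WRONG\<close>
      have l: "(\<lambda>n. s - u (n + n0)) \<longlonglongrightarrow> s - 0"
        by (intro tendsto_intros LIMSEQ_ignore_initial_segment u)
      have "isCont I s" unfolding I_def isCont_indicator
        using elim by (auto simp: frontier_def)
      then have "(\<lambda>n. I (s - u (n + n0))) \<longlonglongrightarrow> I s"
        using l by (auto intro: isCont_tendsto_compose)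
      moreover have "(\<lambda>n. g (s - u (n + n0))) \<longlonglongrightarrow> g s"
        using l g by (auto intro: isCont_tendsto_compose simp: continuous_on_eq_continuous_at)
      ultimately show ?case unfolding F_def by (auto intro!: tendsto_intros)
    qed
    show "AE s in lborel. norm (F (u (n + n0)) s) \<le> B * indicator {-pi - 1..pi + 1} s" for n
    proof (rule AE_I2)
      fix s
      have "\<bar>g (s - u (n + n0)) * \<psi> s\<bar> \<le> B * 1"
        unfolding abs_mult by (intro mult_mono B b) (use B[of 0] in auto)
      then show "norm (F (u (n + n0)) s) \<le> B * indicator {-pi - 1..pi + 1} s"
        using n0[of "n + n0"] unfolding F_def I_def
        by (auto simp: indicator_def abs_less_iff)
    qed
    show "integrable lborel (\<lambda>s. B * indicator {-pi - 1..pi + 1} s)"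
      by (intro integrable_mult_right) simp
  qed (auto simp: F_def)
  then have "(\<lambda>n. corr g \<psi> (u (n + n0))) \<longlonglongrightarrow> corr g \<psi> 0" unfolding eq .
  then show ?thesis by (rule LIMSEQ_offset)
qed

lemma corr_diff:
  assumes \<psi> [measurable]: "\<psi> \<in> borel_measurable borel" and b: "\<And>t. \<bar>\<psi> t\<bar> \<le> 1"
    and "integrable circ K" "integrable circ g"
  shows "corr K \<psi> u - corr g \<psi> u = corr (\<lambda>t. K t - g t) \<psi> u"
  using integrable_corr[OF assms(1,2)] assms(3,4) by (simp add: corr_def left_diff_distrib)

lemma isCont_corr_0:
  assumes \<psi> [measurable]: "\<psi> \<in> borel_measurable borel" and b: "\<And>t. \<bar>\<psi> t\<bar> \<le> 1"
    and K [measurable]: "K \<in> borel_measurable borel" and iK: "integrable circ K"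
  shows "isCont (corr K \<psi>) 0"
  unfolding continuous_at_sequentially
proof (intro allI impI)
  fix u :: "nat \<Rightarrow> real" assume u: "u \<longlonglongrightarrow> 0"
  show "(corr K \<psi> \<circ> u) \<longlonglongrightarrow> corr K \<psi> 0"
  proof (rule LIMSEQ_I)
    fix e :: real assume e: "e > 0"
    obtain g B where g: "continuous_on UNIV g" "\<And>x. \<bar>g x\<bar> \<le> B" "(LINT t|circ. \<bar>K t - g t\<bar>) < e / 3"
      using L1_approx_continuous[OF K iK, of "e / 3"] e by auto
    have "g \<in> borel_measurable borel" using g(1) by (rule borel_measurable_continuous_onI)
    then have ig: "integrable circ g"
      using g(2) by (rule integrable_circ_bounded)
    have d: "\<bar>corr K \<psi> v - corr g \<psi> v\<bar> < e / 3" for v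
      using abs_corr_le[OF \<psi> b, of "\<lambda>t. K t - g t" v] g(3) iK ig by (simp add: corr_diff[OF \<psi> b iK ig])
    obtain N where N: "\<And>n. n \<ge> N \<Longrightarrow> norm (corr g \<psi> (u n) - corr g \<psi> 0) < e / 3"
      using LIMSEQ_D[OF corr_continuous_lim[OF \<psi> b g(1,2) u], of "e / 3"] e by auto
    show "\<exists>N. \<forall>n\<ge>N. norm ((corr K \<psi> \<circ> u) n - corr K \<psi> 0) < e"
    proof (intro exI allI impI)
      fix n assume "n \<ge> N"
      then show "norm ((corr K \<psi> \<circ> u) n - corr K \<psi> 0) < e"
        using N[of n] d[of "u n"] d[of 0] by (simp add: abs_if split: if_splits)
    qed
  qed
qed

lemma corr_measurable:
  assumes [measurable]: "\<psi> \<in> borel_measurable borel" "K \<in> borel_measurable borel"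
  shows "corr K \<psi> \<in> borel_measurable borel"
proof -
  have "(\<lambda>(u, t). K t * \<psi> (u + t)) \<in> borel_measurable (borel \<Otimes>\<^sub>M circ)"
    by (rule measurable_pair_mono[OF _ _ borel_imp_circ]) measurable
  from sigma_finite_measure.borel_measurable_lebesgue_integral[OF sigma_finite_circ this]
  show ?thesis unfolding corr_def[abs_def] by simp
qed

lemma corr_antiperiodic:
  assumes \<psi> [measurable]: "\<psi> \<in> borel_measurable borel" and p: "periodic \<psi>"
    and K [measurable]: "K \<in> borel_measurable borel"
    and anti: "AE t in circ. \<psi> (t + h) = - \<psi> t"
  shows "corr K \<psi> (u + h) = - corr K \<psi> u"
proof -
  have "periodic (\<lambda>t. \<psi> (t + h) = - \<psi> t)"
    using p periodic_shift[OF p, of h] by (simp add: periodic_def)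
  from AE_circ_shift[OF _ this anti, of u]
  have *: "AE t in circ. \<psi> (t + u + h) = - \<psi> (t + u)" by simp
  have "corr K \<psi> (u + h) = (LINT t|circ. - (K t * \<psi> (u + t)))"
    unfolding corr_def
  proof (rule integral_cong_AE)
    show "AE t in circ. K t * \<psi> (u + h + t) = - (K t * \<psi> (u + t))"
      using * by eventually_elim (simp add: algebra_simps)
  qed (intro borel_imp_circ; measurable)+
  then show ?thesis by (simp add: corr_def)
qed

text \<open>The witness is \<open>sgn (cos (m u))\<close> restricted to where \<open>\<bar>cos (m u)\<bar>\<close> is close to 1, that is, near the
  multiples \<open>j \<pi> / m\<close>; there its sign is \<open>(-1)\<^sup>j\<close>, which matches \<open>G (j \<pi> / m) = (-1)\<^sup>j G 0\<close>.\<close>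

lemma antiperiodic_concentrated:
  fixes G :: "real \<Rightarrow> real"
  assumes G: "G \<in> borel_measurable circ" and B: "\<And>u. \<bar>G u\<bar> \<le> B" and cont: "isCont G 0"
    and m: "m \<ge> 1" and anti: "\<And>u. G (u + pi / real m) = - G u" and \<delta>: "\<delta> > 0"
  obtains \<phi> C where "\<phi> \<in> borel_measurable borel" "periodic \<phi>" "\<And>t. \<bar>\<phi> t\<bar> \<le> C"
    "\<And>t. \<phi> (t + pi / real m) = - \<phi> t" "(LINT t|circ. \<bar>\<phi> t\<bar>) = 1" "(LINT u|circ. \<phi> u * G u) \<ge> G 0 - \<delta>"
proof -
  define h where "h = pi / real m"
  have h: "h > 0" "real m * h = pi" using m by (auto simp: h_def)
  obtain d where d: "d > 0" "\<And>v. \<bar>v\<bar> < d \<Longrightarrow> \<bar>G v - G 0\<bar> < \<delta>"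
    using cont \<delta> unfolding continuous_at_eps_delta by (auto simp: dist_real_def)
  define r where "r = min d (h / 2) / 2"
  have r: "0 < r" "r < d" "r < h / 2" using d(1) h(1) by (auto simp: r_def min_def)
  have mr: "0 \<le> real m * r" "real m * r < pi / 2" "0 < real m * r" using r h m
    by (auto simp: h_def field_simps)
  have le: "real m * r \<le> pi" using mr pi_gt_zero by linarith
  define A where "A = {u. \<bar>cos (real m * u)\<bar> > cos (real m * r)}"
  have cosh: "cos (real m * (u + h)) = - cos (real m * u)" for u
    by (simp add: distrib_left h)
  define P where "P u = (sgn (cos (real m * u)) * G u, \<bar>cos (real m * u)\<bar>)" for u
  have P: "P (u + h) = P u" for u
    unfolding P_def cosh anti[folded h_def] by (simp add: sgn_minus)
  have low: "sgn (cos (real m * u)) * G u \<ge> G 0 - \<delta>" if "u \<in> A" for u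
  proof -
    define k where "k = \<lfloor>u / h + 1 / 2\<rfloor>"
    define v where "v = u + h * of_int (- k)"
    have "of_int k \<le> u / h + 1 / 2" "u / h + 1 / 2 < of_int k + 1" unfolding k_def by linarith+
    then have "v \<le> h / 2" "- v \<le> h / 2" using h(1) by (auto simp: v_def field_simps)
    then have v: "\<bar>v\<bar> \<le> h / 2" by linarith
    have Pv: "P v = P u" unfolding v_def by (rule add_int_mult_period[where f=P and p=h, OF P])
    have mv: "real m * \<bar>v\<bar> \<le> pi / 2"
      using mult_left_mono[OF v, of "real m"] h(2) by simp
    have c: "cos (real m * v) = cos (real m * \<bar>v\<bar>)" by (auto simp: abs_if)
    have "cos (real m * v) \<ge> 0" unfolding c using mv by (intro cos_ge_zero) (auto intro: order_trans[of _ 0])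
    moreover have "cos (real m * r) < \<bar>cos (real m * v)\<bar>"
      using that Pv by (simp add: A_def P_def)
    ultimately have gt: "cos (real m * r) < cos (real m * \<bar>v\<bar>)" "cos (real m * v) > 0"
      using cos_gt_zero_pi[of "real m * r"] mr c by auto
    have "\<bar>v\<bar> < r"
    proof (rule ccontr)
      assume "\<not> \<bar>v\<bar> < r"
      then have "real m * r \<le> real m * \<bar>v\<bar>" by (intro mult_left_mono) auto
      then have "cos (real m * \<bar>v\<bar>) \<le> cos (real m * r)"
        using mr mv by (intro cos_monotone_0_pi_le) auto
      then show False using gt by simp
    qed
    then have "\<bar>G v - G 0\<bar> < \<delta>" using r by (intro d) auto
    moreover have "sgn (cos (real m * u)) * G u = G v" using Pv gt by (simp add: P_def)
    ultimately show ?thesis by linarith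
  qed
  have A [measurable]: "A \<in> sets borel" unfolding A_def by measurable
  define c where "c = (LINT u|circ. indicator A u :: real)"
  have iA: "integrable circ (indicator S :: real \<Rightarrow> real)" if "S \<in> sets borel" for S
    using that by (intro integrable_circ_bounded[where B=1]) (auto simp: indicator_def)
  have "0 < r / 2" using r by simp
  also have "\<dots> = (LINT u|circ. indicator {0..r / 2} u)"
  proof -
    have "h \<le> pi" using m by (simp add: h_def field_simps)
    then have "{0..r / 2} \<subseteq> {-pi..pi}" using r by auto
    then show ?thesis using r
      by (subst integral_circ_eq_lborel) (auto simp flip: indicator_inter_arith simp: inf_absorb2)
  qed
  also have "\<dots> \<le> c" unfolding c_def
  proof (intro integral_mono iA)
    fix u
    show "indicator {0..r / 2} u \<le> (indicator A u :: real)"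
    proof (cases "u \<in> {0..r / 2}")
      case True
      then have "cos (real m * r) < cos (real m * u)"
        using r m mr le by (intro cos_monotone_0_pi) auto
      then show ?thesis using True by (auto simp: A_def indicator_def)
    qed auto
  qed auto
  finally have c: "c > 0" .
  define \<phi> where "\<phi> u = sgn (cos (real m * u)) * indicator A u / c" for u
  have sgn_A: "\<bar>sgn (cos (real m * u))\<bar> * indicator A u = indicator A u" for u
    using cos_gt_zero_pi[of "real m * r"] mr by (auto simp: A_def indicator_def abs_sgn_eq)
  show thesis
  proof (rule that)
    show \<phi> [measurable]: "\<phi> \<in> borel_measurable borel" unfolding \<phi>_def[abs_def] by measurable
    have anti': "\<phi> (t + h) = - \<phi> t" for t
      unfolding \<phi>_def cosh by (simp add: A_def indicator_def cosh sgn_minus)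
    then show "\<phi> (t + pi / real m) = - \<phi> t" for t by (simp add: h_def)
    have "\<phi> (t + (h + h)) = \<phi> t" for t using anti'[of "t + h"] anti'[of t] by (simp add: add.assoc)
    then have per: "\<phi> (t + (h + h) * of_int (int m)) = \<phi> t" for t
      by (rule add_int_mult_period)
    have hm: "(h + h) * of_int (int m) = 2 * pi" using h by (simp add: algebra_simps)
    show "periodic \<phi>" unfolding periodic_def using per unfolding hm by blast
    have abs_\<phi>: "\<bar>\<phi> t\<bar> = indicator A t / c" for t
      using sgn_A[of t] c by (simp add: \<phi>_def abs_mult)
    then show bound: "\<bar>\<phi> t\<bar> \<le> 1 / c" for t using c by (simp add: indicator_def divide_right_mono)
    show "(LINT t|circ. \<bar>\<phi> t\<bar>) = 1" unfolding abs_\<phi> using c by (simp add: c_def)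
    have iG: "integrable circ G"
      using finite_measure.integrable_const_bound[OF finite_measure_circ, of G B] G B by simp
    have i\<phi>G: "integrable circ (\<lambda>u. \<phi> u * G u)"
      using integrable_mult_bounded[OF iG, of \<phi> "1 / c"] bound
      by (simp add: borel_imp_circ mult.commute)
    have "G 0 - \<delta> = (LINT u|circ. (G 0 - \<delta>) / c * indicator A u)"
      using c by (simp add: c_def)
    also have "\<dots> \<le> (LINT u|circ. \<phi> u * G u)"
    proof (intro integral_mono i\<phi>G)
      show "integrable circ (\<lambda>u. (G 0 - \<delta>) / c * indicator A u)"
        by (intro integrable_mult_right iA A)
      fix u
      show "(G 0 - \<delta>) / c * indicator A u \<le> \<phi> u * G u"
        using low[of u] c by (cases "u \<in> A") (auto simp: \<phi>_def divide_right_mono)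
    qed
    finally show "(LINT u|circ. \<phi> u * G u) \<ge> G 0 - \<delta>" .
  qed
qed

section \<open>Sharpness for Borel kernels\<close>

lemma integrable_pair_mult_bounded:
  fixes K :: "real \<Rightarrow> real" and F :: "real \<times> real \<Rightarrow> real"
  assumes K [measurable]: "K \<in> borel_measurable borel" and i: "integrable circ K"
    and F: "F \<in> borel_measurable (borel \<Otimes>\<^sub>M borel)" and b: "\<And>p. \<bar>F p\<bar> \<le> C"
  shows "integrable (circ \<Otimes>\<^sub>M circ) (\<lambda>p. K (snd p) * F p)"
proof (rule integrable_mult_bounded)
  show "F \<in> borel_measurable (circ \<Otimes>\<^sub>M circ)" using F by (rule borel_imp_circ_pair)
  show "AE p in circ \<Otimes>\<^sub>M circ. \<bar>F p\<bar> \<le> C" using b by (intro AE_I2)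
  show "integrable (circ \<Otimes>\<^sub>M circ) (\<lambda>p. K (snd p))"
  proof (rule pair_sigma_finite.Fubini_integrable[OF pair_sigma_finite_circ])
    show "(\<lambda>p. K (snd p)) \<in> borel_measurable (circ \<Otimes>\<^sub>M circ)"
      by (rule borel_imp_circ_pair) measurable
    show "integrable circ (\<lambda>x. LINT y|circ. norm (K (snd (x, y))))"
      by (simp add: finite_measure.integrable_const[OF finite_measure_circ])
  qed (use i in simp)
qed

lemma conv_corr_duality:
  fixes K \<phi> \<psi> :: "real \<Rightarrow> real"
  assumes K [measurable]: "K \<in> borel_measurable borel" and iK: "integrable circ K"
    and \<phi> [measurable]: "\<phi> \<in> borel_measurable borel" and p\<phi>: "periodic \<phi>" and C: "\<And>t. \<bar>\<phi> t\<bar> \<le> C"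
    and \<psi> [measurable]: "\<psi> \<in> borel_measurable borel" and p\<psi>: "periodic \<psi>" and b: "\<And>t. \<bar>\<psi> t\<bar> \<le> 1"
  shows "(LINT x|circ. \<psi> x * conv \<phi> K x) = 1 / (2 * pi) * (LINT u|circ. \<phi> u * corr K \<psi> u)"
proof -
  have bd: "\<bar>a * c\<bar> \<le> 1 * C" if "\<bar>a\<bar> \<le> 1" "\<bar>c\<bar> \<le> C" for a c :: real
    unfolding abs_mult using that by (intro mult_mono) auto
  have i1: "integrable (circ \<Otimes>\<^sub>M circ) (\<lambda>(x, t). K t * (\<psi> x * \<phi> (x - t)))"
    using integrable_pair_mult_bounded[OF K iK, of "\<lambda>(x, t). \<psi> x * \<phi> (x - t)" "1 * C"] bd[OF b C]
    by (simp add: case_prod_unfold)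
  have i2: "integrable (circ \<Otimes>\<^sub>M circ) (\<lambda>(u, t). K t * (\<psi> (u + t) * \<phi> u))"
    using integrable_pair_mult_bounded[OF K iK, of "\<lambda>(u, t). \<psi> (u + t) * \<phi> u" "1 * C"] bd[OF b C]
    by (simp add: case_prod_unfold)
  have "(LINT x|circ. \<psi> x * (LINT t|circ. \<phi> (x - t) * K t)) = (LINT x|circ. LINT t|circ. K t * (\<psi> x * \<phi> (x - t)))"
    by (simp flip: integral_mult_right_zero add: ac_simps)
  also have "\<dots> = (LINT t|circ. LINT x|circ. K t * (\<psi> x * \<phi> (x - t)))"
    by (rule pair_sigma_finite.Fubini_integral[OF pair_sigma_finite_circ i1, symmetric])
  also have "\<dots> = (LINT t|circ. LINT u|circ. K t * (\<psi> (u + t) * \<phi> u))"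
  proof (rule Bochner_Integration.integral_cong[OF refl])
    fix t
    have "periodic (\<lambda>x. K t * (\<psi> x * \<phi> (x + - t)))"
      using p\<psi> periodic_shift[OF p\<phi>, of "- t"] unfolding periodic_def by metis
    moreover have "(\<lambda>x. K t * (\<psi> x * \<phi> (x + - t))) \<in> borel_measurable borel" by measurable
    ultimately have "(LINT x|circ. K t * (\<psi> x * \<phi> (x + - t))) = (LINT x|circ. K t * (\<psi> (x + t) * \<phi> (x + t + - t)))"
      by (intro integral_circ_shift[symmetric])
    then
    show "(LINT x|circ. K t * (\<psi> x * \<phi> (x - t))) = (LINT u|circ. K t * (\<psi> (u + t) * \<phi> u))"
      by (simp only: diff_conv_add_uminus add.assoc right_minus add_0_right)
  qed
  also have "\<dots> = (LINT u|circ. LINT t|circ. K t * (\<psi> (u + t) * \<phi> u))"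
    by (rule pair_sigma_finite.Fubini_integral[OF pair_sigma_finite_circ i2])
  also have "\<dots> = (LINT u|circ. \<phi> u * corr K \<psi> u)"
    unfolding corr_def by (simp flip: integral_mult_right_zero add: ac_simps)
  finally show ?thesis by (simp add: conv_def flip: integral_mult_right_zero)
qed

locale borel_B_star =
  fixes n m :: nat and K T \<psi> :: "real \<Rightarrow> real"
  assumes n: "1 \<le> n" "n \<le> m"
    and K [measurable]: "K \<in> borel_measurable borel" and iK: "integrable circ K"
    and T: "T \<in> trig_polys n"
    and \<psi> [measurable]: "\<psi> \<in> borel_measurable borel" and p\<psi>: "periodic \<psi>" and b\<psi>: "\<And>t. \<bar>\<psi> t\<bar> \<le> 1"
    and sign: "AE t in circ. \<psi> t * (K t - T t) = \<bar>K t - T t\<bar>"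
    and anti: "AE t in circ. \<psi> (t + pi / real m) = - \<psi> t"
begin

definition "M = (LINT t|circ. \<bar>K t - T t\<bar>)"

lemma integrable_poly: "S \<in> trig_polys n \<Longrightarrow> integrable circ S"
  using trig_polys_bounded[OF _ n(1)] by (metis integrable_circ_bounded trig_polys_borel)

lemma orth_\<psi>: "orth n \<psi>"
  by (rule antiperiodic_imp_orth[OF \<psi> p\<psi> integrable_circ_bounded[OF \<psi> b\<psi>] n anti])

lemma orth_sign_diff:
  assumes "integrable circ f" "S \<in> trig_polys n"
  shows "(LINT t|circ. \<psi> t * (f t - S t)) = (LINT t|circ. \<psi> t * f t)"
proof -
  have "integrable circ (\<lambda>t. \<psi> t * g t)" if "integrable circ g" for g
    using integrable_mult_bounded[OF that, of \<psi> 1] b\<psi> by (simp add: borel_imp_circ mult.commute)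
  then show ?thesis
    using assms orth_\<psi> integrable_poly[OF assms(2)] by (simp add: right_diff_distrib orth_def)
qed

lemma corr_0: "corr K \<psi> 0 = M"
proof -
  have "M = (LINT t|circ. \<psi> t * (K t - T t))"
    unfolding M_def
  proof (rule integral_cong_AE)
    show "AE t in circ. \<bar>K t - T t\<bar> = \<psi> t * (K t - T t)"
      using sign by eventually_elim simp
  qed (use trig_polys_borel[OF T] in \<open>intro borel_imp_circ; measurable\<close>)+
  also have "\<dots> = corr K \<psi> 0"
    using orth_sign_diff[OF iK T] by (simp add: corr_def mult.commute)
  finally show ?thesis ..
qed

lemma Lp_norm_1_diff_ge:
  assumes f: "integrable circ f" "S \<in> trig_polys n"
  shows "Lp_norm 1 (\<lambda>t. f t - S t) \<ge> ennreal (LINT t|circ. \<psi> t * f t)"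
proof -
  have i: "integrable circ (\<lambda>t. f t - S t)" using f integrable_poly by auto
  have "(LINT t|circ. \<psi> t * f t) = (LINT t|circ. \<psi> t * (f t - S t))"
    using orth_sign_diff[OF f] by simp
  also have "\<dots> \<le> (LINT t|circ. \<bar>f t - S t\<bar>)"
  proof (rule integral_mono)
    show "integrable circ (\<lambda>t. \<psi> t * (f t - S t))"
      using integrable_mult_bounded[OF i, of \<psi> 1] b\<psi> by (simp add: borel_imp_circ mult.commute)
    fix t
    show "\<psi> t * (f t - S t) \<le> \<bar>f t - S t\<bar>"
      using mult_right_mono[OF b\<psi>[of t], of "\<bar>f t - S t\<bar>"] by (simp add: abs_le_iff flip: abs_mult)
  qed (use i in auto)
  finally show ?thesis using i by (simp add: Lp_norm_1_eq_integral ennreal_leI)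
qed

lemma Lp_norm_1_diff: "Lp_norm 1 (\<lambda>t. K t - T t) = ennreal M"
  unfolding M_def using iK integrable_poly[OF T] by (simp add: Lp_norm_1_eq_integral)

lemma best_approx_1: "best_approx n 1 K = ennreal M"
  unfolding best_approx_def
proof (rule antisym)
  show "(INF S\<in>trig_polys n. Lp_norm 1 (\<lambda>t. K t - S t)) \<le> ennreal M"
    using INF_lower[OF T, of "\<lambda>S. Lp_norm 1 (\<lambda>t. K t - S t)"] by (simp add: Lp_norm_1_diff)
  show "ennreal M \<le> (INF S\<in>trig_polys n. Lp_norm 1 (\<lambda>t. K t - S t))"
    using Lp_norm_1_diff_ge[OF iK] corr_0 by (intro INF_greatest) (simp add: corr_def mult.commute)
qed

lemma
  assumes p: "p = 1 \<or> p = \<infinity>" and \<phi>: "\<phi> \<in> borel_measurable borel"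
  shows best_approx_conv_le: "\<phi> \<in> H_ball p 0 \<Longrightarrow> best_approx n p (conv \<phi> K) \<le> ennreal (M / (2 * pi))"
    and Lp_norm_conv_le: "\<phi> \<in> H_ball p n \<Longrightarrow> Lp_norm p (conv \<phi> K) \<le> ennreal (M / (2 * pi))"
proof -
  have M: "ennreal (M / (2 * pi)) = ennreal (1 / (2 * pi)) * ennreal M"
    by (subst ennreal_mult[symmetric]) (auto simp: M_def)
  have le: "Lp_norm p (\<lambda>x. conv \<phi> K x - conv \<phi> T x) \<le> ennreal (M / (2 * pi))"
    if "periodic \<phi>" "integrable circ \<phi>" "Lp_norm p \<phi> \<le> 1"
    using Lp_norm_conv_diff_le[OF p \<phi> that K iK T n(1)] by (simp add: M Lp_norm_1_diff)
  {
    assume "\<phi> \<in> H_ball p 0"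
    then have \<phi>': "periodic \<phi>" "integrable circ \<phi>" "Lp_norm p \<phi> \<le> 1"
      using H_ball_borel_iff[OF \<phi> p n(1)] by auto
    show "best_approx n p (conv \<phi> K) \<le> ennreal (M / (2 * pi))"
      unfolding best_approx_def
      by (rule INF_lower2[OF conv_trig_poly[OF \<phi> \<phi>'(1,2) T n(1)]]) (rule le[OF \<phi>'])
  next
    assume "\<phi> \<in> H_ball p n"
    then have \<phi>': "periodic \<phi>" "integrable circ \<phi>" "Lp_norm p \<phi> \<le> 1" "orth n \<phi>"
      using H_ball_borel_iff[OF \<phi> p n(1)] by auto
    then show "Lp_norm p (conv \<phi> K) \<le> ennreal (M / (2 * pi))"
      using le conv_trig_poly_eq_0[OF \<phi> _ _ T n(1)] by simp
  }
qed

lemma test_function: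
  assumes "\<delta> > 0"
  obtains \<phi> C where "\<phi> \<in> borel_measurable borel" "periodic \<phi>" "\<And>t. \<bar>\<phi> t\<bar> \<le> C"
    "(LINT t|circ. \<bar>\<phi> t\<bar>) = 1" "orth n \<phi>" "(LINT u|circ. \<phi> u * corr K \<psi> u) \<ge> M - \<delta>"
proof -
  have "corr K \<psi> \<in> borel_measurable circ" by (intro borel_imp_circ corr_measurable \<psi> K)
  moreover have "m \<ge> 1" using n by simp
  ultimately show thesis
  proof (rule antiperiodic_concentrated[OF _ abs_corr_le[OF \<psi> b\<psi> iK] isCont_corr_0[OF \<psi> b\<psi> K iK] _
          corr_antiperiodic[OF \<psi> p\<psi> K anti] assms])
    fix \<phi> C
    assume \<phi>: "\<phi> \<in> borel_measurable borel" "periodic \<phi>" "\<And>t. \<bar>\<phi> t\<bar> \<le> C"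
      "\<And>t. \<phi> (t + pi / real m) = - \<phi> t" "(LINT t|circ. \<bar>\<phi> t\<bar>) = 1" "(LINT u|circ. \<phi> u * corr K \<psi> u) \<ge> corr K \<psi> 0 - \<delta>"
    have "orth n \<phi>"
      using antiperiodic_imp_orth[OF \<phi>(1,2) integrable_circ_bounded[OF \<phi>(1,3)] n] \<phi>(4) by simp
    then show thesis using that[OF \<phi>(1,2,3,5)] \<phi>(6) corr_0 by simp
  qed
qed

lemma best_approx_1_conv_ge:
  assumes "\<delta> > 0"
  obtains \<phi> where "\<phi> \<in> borel_measurable borel" "\<phi> \<in> H_ball 1 n"
    "best_approx n 1 (conv \<phi> K) \<ge> ennreal ((M - \<delta>) / (2 * pi))"
proof -
  obtain \<phi> C where \<phi>: "\<phi> \<in> borel_measurable borel" "periodic \<phi>" "\<And>t. \<bar>\<phi> t\<bar> \<le> C"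
    "(LINT t|circ. \<bar>\<phi> t\<bar>) = 1" "orth n \<phi>" "(LINT u|circ. \<phi> u * corr K \<psi> u) \<ge> M - \<delta>"
    using test_function[OF assms] by blast
  have i\<phi>: "integrable circ \<phi>" using \<phi>(1,3) by (rule integrable_circ_bounded)
  have N\<phi>: "Lp_norm 1 \<phi> = 1" using i\<phi> \<phi>(4) by (simp add: Lp_norm_1_eq_integral)
  have "Lp_norm 1 (conv \<phi> K) \<le> ennreal (1 / (2 * pi)) * (Lp_norm 1 \<phi> * Lp_norm 1 K)"
    by (rule Lp_norm_1_conv_le[OF \<phi>(1,2) K])
  also have "\<dots> < \<infinity>" using iK by (simp add: N\<phi> Lp_norm_1_eq_integral ennreal_mult_less_top)
  finally have i: "integrable circ (conv \<phi> K)"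
    using conv_measurable[OF \<phi>(1) K] by (simp add: integrable_iff_Lp_norm_1)
  show thesis
  proof (rule that[OF \<phi>(1)])
    show "\<phi> \<in> H_ball 1 n" using H_ball_borel_iff(1)[OF \<phi>(1) _ n(1), of 1] \<phi> i\<phi> N\<phi> by simp
    have "(M - \<delta>) / (2 * pi) \<le> (LINT x|circ. \<psi> x * conv \<phi> K x)"
      using conv_corr_duality[OF K iK \<phi>(1-3) \<psi> p\<psi> b\<psi>] \<phi>(6) by (simp add: divide_right_mono)
    then show "best_approx n 1 (conv \<phi> K) \<ge> ennreal ((M - \<delta>) / (2 * pi))"
      unfolding best_approx_def
      by (intro INF_greatest order_trans[OF _ Lp_norm_1_diff_ge[OF i]] ennreal_leI)
  qed
qed

lemma best_approx_infinity_conv_ge: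
  assumes "\<delta> > 0"
  obtains \<phi> where "\<phi> \<in> borel_measurable borel" "\<phi> \<in> H_ball \<infinity> n"
    "best_approx n \<infinity> (conv \<phi> K) \<ge> ennreal ((M - \<delta>) / (2 * pi))"
proof -
  obtain \<phi> C where \<phi>: "\<phi> \<in> borel_measurable borel" "periodic \<phi>" "\<And>t. \<bar>\<phi> t\<bar> \<le> C"
    "(LINT t|circ. \<bar>\<phi> t\<bar>) = 1" "orth n \<phi>" "(LINT u|circ. \<phi> u * corr K \<psi> u) \<ge> M - \<delta>"
    using test_function[OF assms] by blast
  note [measurable] = \<phi>(1) corr_measurable[OF \<psi> K]
  define f where "f = conv (\<lambda>t. \<psi> (- t)) K"
  have f: "f x = 1 / (2 * pi) * corr K \<psi> (- x)" for x
    by (simp add: f_def conv_def corr_def mult.commute)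
  have pr: "periodic (\<lambda>t. \<psi> (- t))" using periodic_reflect[OF p\<psi>, of 0] by simp
  have m: "(\<lambda>t. \<psi> (- t)) \<in> borel_measurable borel" by measurable
  have i\<phi>: "integrable circ (\<lambda>t. \<phi> (- t))"
    using \<phi>(3) by (intro integrable_circ_bounded) auto
  show thesis
  proof (rule that[OF m])
    have "Lp_norm \<infinity> (\<lambda>t. \<psi> (- t)) \<le> ennreal 1"
      unfolding Lp_norm_infinity using b\<psi> by (intro esssup_I AE_I2 ennreal_leI borel_imp_circ) auto
    moreover have "integrable circ (\<lambda>t. \<psi> (- t))" using m b\<psi> by (rule integrable_circ_bounded)
    ultimately show "(\<lambda>t. \<psi> (- t)) \<in> H_ball \<infinity> n"
      using H_ball_borel_iff(1)[OF m _ n(1), of \<infinity>] pr orth_reflect[OF \<psi> p\<psi> n(1) orth_\<psi>] by simp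
    show "ennreal ((M - \<delta>) / (2 * pi)) \<le> best_approx n \<infinity> (conv (\<lambda>t. \<psi> (- t)) K)"
      unfolding best_approx_def f_def[symmetric]
    proof (rule INF_greatest)
      fix S assume S: "S \<in> trig_polys n"
      have [measurable]: "S \<in> borel_measurable borel" using S by (rule trig_polys_borel)
      show "ennreal ((M - \<delta>) / (2 * pi)) \<le> Lp_norm \<infinity> (\<lambda>t. f t - S t)"
      proof (cases "Lp_norm \<infinity> (\<lambda>t. f t - S t)" rule: ennreal_cases)
        case top then show ?thesis by simp
      next
        case (real c)
        then have c: "AE t in circ. \<bar>f t - S t\<bar> \<le> c" by (intro AE_le_of_Lp_norm_infinity) auto
        have pc: "periodic (\<lambda>u. \<phi> u * corr K \<psi> u)"
        proof -
          have "corr K \<psi> (u + 2 * pi) = corr K \<psi> u" for u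
          proof -
            have "\<psi> (u + 2 * pi + t) = \<psi> (u + t)" for t
              using p\<psi>[unfolded periodic_def, rule_format, of "u + t"] by (simp add: algebra_simps)
            then show ?thesis by (simp add: corr_def)
          qed
          then show ?thesis using \<phi>(2) by (simp add: periodic_def)
        qed
        have fb: "\<bar>f x\<bar> \<le> 1 / (2 * pi) * (LINT t|circ. \<bar>K t\<bar>)" for x
          using abs_corr_le[OF \<psi> b\<psi> iK, of "- x"] by (simp add: f abs_mult divide_right_mono)
        have fm: "f \<in> borel_measurable borel" unfolding f[abs_def] by measurable
        have i1: "integrable circ (\<lambda>t. \<phi> (- t) * f t)"
          using fb fm by (intro integrable_mult_bounded[OF i\<phi>]) (auto intro!: borel_imp_circ)
        have i2: "integrable circ (\<lambda>t. \<phi> (- t) * S t)"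
          by (rule integrable_mult_trig_poly[OF i\<phi> S n(1)])
        have "(M - \<delta>) / (2 * pi) \<le> 1 / (2 * pi) * (LINT u|circ. \<phi> u * corr K \<psi> u)"
          using \<phi>(6) by (simp add: divide_right_mono)
        also have "(LINT u|circ. \<phi> u * corr K \<psi> u) = (LINT u|circ. \<phi> (0 - u) * corr K \<psi> (0 - u))"
          by (rule integral_circ_reflect[symmetric, OF _ pc]) measurable
        also have "1 / (2 * pi) * \<dots> = (LINT u|circ. \<phi> (- u) * f u)"
          by (simp add: f flip: integral_mult_right_zero)
        also have "\<dots> = (LINT u|circ. \<phi> (- u) * (f u - S u))"
          using i1 i2 orth_reflect[OF \<phi>(1,2) n(1) \<phi>(5)] S by (simp add: right_diff_distrib orth_def)
        also have "\<dots> \<le> (LINT u|circ. \<bar>\<phi> (0 - u)\<bar> * c)"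
        proof (rule integral_mono_AE)
          show "AE u in circ. \<phi> (- u) * (f u - S u) \<le> \<bar>\<phi> (0 - u)\<bar> * c"
            using c
          proof eventually_elim
            case (elim u)
            have "\<phi> (- u) * (f u - S u) \<le> \<bar>\<phi> (- u)\<bar> * \<bar>f u - S u\<bar>" by (metis abs_ge_self abs_mult)
            also have "\<dots> \<le> \<bar>\<phi> (- u)\<bar> * c" using elim by (intro mult_left_mono) auto
            finally show ?case by simp
          qed
        qed (use i1 i2 i\<phi> in \<open>auto simp: right_diff_distrib\<close>)
        also have "\<dots> = c"
          using integral_circ_reflect[of "\<lambda>u. \<bar>\<phi> u\<bar>" 0] \<phi>(2,4) by (simp add: periodic_def)
        finally show ?thesis using real by (simp add: ennreal_leI)
      qed
    qed
  qed
qed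

end

section \<open>Reduction to Borel representatives\<close>

lemma AE_lebesgue_affine:
  fixes t c :: real
  assumes "AE x in lebesgue. Q x" "c \<noteq> 0"
  shows "AE x in lebesgue. Q (t + c * x)"
  using AE_lborel_affine[of Q c t] assms by (simp add: AE_completion_iff)

lemma borel_imp_lebesgue: "f \<in> borel_measurable borel \<Longrightarrow> f \<in> borel_measurable lebesgue"
  by (rule measurable_completion) simp

lemma lebesgue_imp_circ: "f \<in> borel_measurable lebesgue \<Longrightarrow> f \<in> borel_measurable circ"
  by (rule measurable_restrict_space1)

lemma
  assumes f: "f \<in> borel_measurable lebesgue" and g: "g \<in> borel_measurable lebesgue"
    and ae: "AE t in lebesgue. f t = g t"
  shows Lp_norm_cong_AE: "Lp_norm p f = Lp_norm p g"
    and fourier_coeff_cong_AE: "fourier_coeff f k = fourier_coeff g k"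
proof -
  have [measurable]: "f \<in> borel_measurable circ" "g \<in> borel_measurable circ"
    using f g by (auto intro: lebesgue_imp_circ)
  have ae': "AE t in circ. f t = g t" using ae by (rule AE_lebesgue_imp_circ)
  have "esssup circ (\<lambda>t. ennreal \<bar>f t\<bar>) = esssup circ (\<lambda>t. ennreal \<bar>g t\<bar>)"
    using ae' by (intro esssup_AE_cong) (auto elim!: eventually_mono)
  moreover have "(\<integral>\<^sup>+t. ennreal (\<bar>f t\<bar> powr enn2real p) \<partial>circ) = (\<integral>\<^sup>+t. ennreal (\<bar>g t\<bar> powr enn2real p) \<partial>circ)"
    using ae' by (intro nn_integral_cong_AE) (auto elim!: eventually_mono)
  ultimately show "Lp_norm p f = Lp_norm p g" by (simp add: Lp_norm_def)
  have e: "(\<lambda>t. exp (- \<i> * of_int k * of_real t)) \<in> borel_measurable circ"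
    by (intro borel_imp_circ borel_measurable_continuous_onI continuous_intros)
  have "(LINT t|circ. of_real (f t) * exp (- \<i> * of_int k * of_real t))
      = (LINT t|circ. of_real (g t) * exp (- \<i> * of_int k * of_real t))"
  proof (rule integral_cong_AE)
    show "AE t in circ. of_real (f t) * exp (- \<i> * of_int k * of_real t) = of_real (g t) * exp (- \<i> * of_int k * of_real t)"
      using ae' by eventually_elim simp
  qed (intro borel_measurable_times borel_measurable_of_real e; measurable)+
  then show "fourier_coeff f k = fourier_coeff g k" by (simp add: fourier_coeff_def)
qed

lemma conv_cong_AE:
  fixes \<phi> \<phi>' K K' :: "real \<Rightarrow> real"
  assumes \<phi>: "\<phi> \<in> borel_measurable lebesgue" and \<phi>': "\<phi>' \<in> borel_measurable lebesgue"
    and "AE t in lebesgue. \<phi> t = \<phi>' t"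
    and K: "K \<in> borel_measurable lebesgue" and K': "K' \<in> borel_measurable lebesgue"
    and "AE t in lebesgue. K t = K' t"
  shows "conv \<phi> K = conv \<phi>' K'"
proof
  fix x :: real
  have "(\<lambda>t. x + (-1) * t) \<in> lebesgue \<rightarrow>\<^sub>M lebesgue"
    using lebesgue_affine_measurable[where c="\<lambda>x::real. -1" and t=x] by simp
  then have r: "(\<lambda>t. x - t) \<in> lebesgue \<rightarrow>\<^sub>M lebesgue" by simp
  have m: "(\<lambda>t. f (x - t) * g t) \<in> borel_measurable circ"
    if "f \<in> borel_measurable lebesgue" "g \<in> borel_measurable lebesgue" for f g :: "real \<Rightarrow> real"
    by (intro lebesgue_imp_circ borel_measurable_times measurable_compose[OF r] that)
  have "AE t in lebesgue. \<phi> (x - t) = \<phi>' (x - t)"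
    using AE_lebesgue_affine[OF assms(3), of "-1" x] by simp
  with assms(6) have "AE t in lebesgue. \<phi> (x - t) * K t = \<phi>' (x - t) * K' t" by eventually_elim simp
  then have "(LINT t|circ. \<phi> (x - t) * K t) = (LINT t|circ. \<phi>' (x - t) * K' t)"
    by (intro integral_cong_AE m assms AE_lebesgue_imp_circ)
  then show "conv \<phi> K x = conv \<phi>' K' x" by (simp add: conv_def)
qed

lemma conv_class_borel:
  assumes K: "K \<in> borel_measurable lebesgue" and K': "K' \<in> borel_measurable borel"
    and ae: "AE t in lebesgue. K t = K' t"
  shows "conv_class p s K = (\<lambda>\<phi>. conv \<phi> K') ` (H_ball p s \<inter> borel_measurable borel)"
proof -
  have K'l: "K' \<in> borel_measurable lebesgue" using K' by (rule borel_imp_lebesgue)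
  have eq: "conv_class p s K = (\<lambda>\<phi>. conv \<phi> K) ` H_ball p s"
    by (auto simp: conv_class_def conv_def[abs_def])
  have 1: "\<exists>\<phi>'\<in>H_ball p s \<inter> borel_measurable borel. conv \<phi> K = conv \<phi>' K'" if \<phi>: "\<phi> \<in> H_ball p s" for \<phi>
  proof -
    have l: "\<phi> \<in> borel_measurable lebesgue" "periodic \<phi>"
      using \<phi> by (auto simp: H_ball_def Lp_def periodic_def)
    obtain \<phi>' where \<phi>': "\<phi>' \<in> borel_measurable borel" "periodic \<phi>'" "AE x in lebesgue. \<phi> x = \<phi>' x"
      using periodic_borel_version[OF l] .
    note l' = borel_imp_lebesgue[OF \<phi>'(1)]
    have "\<phi>' \<in> H_ball p s"
      using \<phi> \<phi>'(2) l' Lp_norm_cong_AE[OF l(1) l' \<phi>'(3)] fourier_coeff_cong_AE[OF l(1) l' \<phi>'(3)]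
      by (simp add: H_ball_def Lp_def periodic_def)
    then show ?thesis using conv_cong_AE[OF l(1) l' \<phi>'(3) K K'l ae] \<phi>'(1) by blast
  qed
  have 2: "conv \<phi> K' = conv \<phi> K" if "\<phi> \<in> borel_measurable borel" for \<phi>
    by (rule conv_cong_AE[OF _ _ _ K'l K]) (use that ae in \<open>auto intro: borel_imp_lebesgue\<close>)
  show ?thesis unfolding eq
  proof (intro equalityI image_subsetI)
    fix \<phi> assume "\<phi> \<in> H_ball p s"
    then show "conv \<phi> K \<in> (\<lambda>\<phi>. conv \<phi> K') ` (H_ball p s \<inter> borel_measurable borel)"
      using 1 by (simp add: image_iff)
  next
    fix \<phi> assume "\<phi> \<in> H_ball p s \<inter> borel_measurable borel"
    then show "conv \<phi> K' \<in> (\<lambda>\<phi>. conv \<phi> K) ` H_ball p s"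
      by (auto simp: 2)
  qed
qed

lemma ennreal_le_diff_epsilon:
  assumes "\<And>\<delta>. \<delta> > 0 \<Longrightarrow> ennreal ((M - \<delta>) / c) \<le> X" "c > 0"
  shows "ennreal (M / c) \<le> X"
proof (rule ennreal_le_epsilon)
  fix e :: real assume e: "e > 0"
  have "ennreal (M / c) \<le> ennreal ((M - e * c) / c) + ennreal e"
  proof (cases "M - e * c \<ge> 0")
    case True
    have "M / c = (M - e * c) / c + e" using assms(2) by (simp add: field_simps)
    also have "ennreal \<dots> = ennreal ((M - e * c) / c) + ennreal e"
      using True assms(2) e by (intro ennreal_plus) auto
    finally show ?thesis by simp
  next
    case False
    then have "M / c \<le> e" using assms(2) by (simp add: field_simps)
    then show ?thesis by (simp add: add_increasing ennreal_leI)
  qed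
  also have "\<dots> \<le> X + ennreal e"
    using assms e by (intro add_right_mono assms(1)) simp
  finally show "ennreal (M / c) \<le> X + ennreal e" .
qed

lemma H_ball_antimono: "s \<le> n \<Longrightarrow> H_ball p n \<subseteq> H_ball p s"
  by (auto simp: H_ball_def)

lemma best_approx_le_Lp_norm: "best_approx n p f \<le> Lp_norm p f"
  unfolding best_approx_def using INF_lower[OF trig_polys_zero, of "\<lambda>T. Lp_norm p (\<lambda>t. f t - T t)"] by simp

lemma (in borel_B_star) SUP_conv_eq:
  assumes p: "p = 1 \<or> p = \<infinity>" and s: "s \<le> n"
  shows "(SUP \<phi>\<in>H_ball p s \<inter> borel_measurable borel. best_approx n p (conv \<phi> K)) = ennreal (M / (2 * pi))"
    and "(SUP \<phi>\<in>H_ball p n \<inter> borel_measurable borel. Lp_norm p (conv \<phi> K)) = ennreal (M / (2 * pi))"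
proof -
  have ge: "ennreal (M / (2 * pi)) \<le> (SUP \<phi>\<in>H_ball p n \<inter> borel_measurable borel. best_approx n p (conv \<phi> K))"
  proof (rule ennreal_le_diff_epsilon)
    fix \<delta> :: real assume \<delta>: "\<delta> > 0"
    obtain \<phi> where "\<phi> \<in> H_ball p n \<inter> borel_measurable borel"
      "ennreal ((M - \<delta>) / (2 * pi)) \<le> best_approx n p (conv \<phi> K)"
    proof (cases "p = 1")
      case True
      show ?thesis by (rule best_approx_1_conv_ge[OF \<delta>]) (use that True in simp)
    next
      case False
      show ?thesis by (rule best_approx_infinity_conv_ge[OF \<delta>]) (use that False p in simp)
    qed
    then show "ennreal ((M - \<delta>) / (2 * pi)) \<le> (SUP \<phi>\<in>H_ball p n \<inter> borel_measurable borel. best_approx n p (conv \<phi> K))"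
      by (intro SUP_upper2)
  qed simp
  show "(SUP \<phi>\<in>H_ball p s \<inter> borel_measurable borel. best_approx n p (conv \<phi> K)) = ennreal (M / (2 * pi))"
  proof (rule antisym)
    show "(SUP \<phi>\<in>H_ball p s \<inter> borel_measurable borel. best_approx n p (conv \<phi> K)) \<le> ennreal (M / (2 * pi))"
      using H_ball_antimono[of 0 s p] by (intro SUP_least best_approx_conv_le[OF p]) auto
    have "H_ball p n \<inter> borel_measurable borel \<subseteq> H_ball p s \<inter> borel_measurable borel"
      using H_ball_antimono[OF s] by auto
    then show "ennreal (M / (2 * pi)) \<le> (SUP \<phi>\<in>H_ball p s \<inter> borel_measurable borel. best_approx n p (conv \<phi> K))"
      by (rule order_trans[OF ge SUP_subset_mono]) (rule order_refl)
  qed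
  show "(SUP \<phi>\<in>H_ball p n \<inter> borel_measurable borel. Lp_norm p (conv \<phi> K)) = ennreal (M / (2 * pi))"
  proof (rule antisym)
    show "(SUP \<phi>\<in>H_ball p n \<inter> borel_measurable borel. Lp_norm p (conv \<phi> K)) \<le> ennreal (M / (2 * pi))"
      by (intro SUP_least Lp_norm_conv_le[OF p]) auto
    show "ennreal (M / (2 * pi)) \<le> (SUP \<phi>\<in>H_ball p n \<inter> borel_measurable borel. Lp_norm p (conv \<phi> K))"
      by (rule order_trans[OF ge SUP_mono']) (rule best_approx_le_Lp_norm)
  qed
qed

theorem mainTheorem1:
  fixes n s :: nat and K T :: "real \<Rightarrow> real"
  assumes "n \<ge> 1"
    and "K \<in> Lp 1"
    and "B_star_with n K T"
    and "s \<le> n"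
  shows "((SUP f\<in>conv_class \<infinity> s K. best_approx n \<infinity> f) = (SUP f\<in>conv_class \<infinity> n K. Lp_norm \<infinity> f)
          \<and> (SUP f\<in>conv_class \<infinity> n K. Lp_norm \<infinity> f) = ennreal (1 / (2 * pi)) * best_approx n 1 K
          \<and> ennreal (1 / (2 * pi)) * best_approx n 1 K
              = ennreal (1 / (2 * pi)) * Lp_norm 1 (\<lambda>t. K t - T t))
       \<and> ((SUP f\<in>conv_class 1 s K. best_approx n 1 f) = (SUP f\<in>conv_class 1 n K. Lp_norm 1 f)
          \<and> (SUP f\<in>conv_class 1 n K. Lp_norm 1 f) = ennreal (1 / (2 * pi)) * best_approx n 1 K
          \<and> ennreal (1 / (2 * pi)) * best_approx n 1 K
              = ennreal (1 / (2 * pi)) * Lp_norm 1 (\<lambda>t. K t - T t))"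
proof -
  have K: "K \<in> borel_measurable lebesgue" "periodic K" "Lp_norm 1 K < \<infinity>"
    using assms(2) by (auto simp: Lp_def periodic_def)
  obtain K' where K': "K' \<in> borel_measurable borel" "AE x in lebesgue. K x = K' x"
    using periodic_borel_version[OF K(1,2)] by blast
  obtain \<psi>0 m where T: "T \<in> trig_polys n" and \<psi>0: "\<psi>0 \<in> Lp \<infinity>" and m: "m \<ge> n"
    and ae: "AE t in lebesgue. \<bar>\<psi>0 t\<bar> \<le> 1 \<and> \<psi>0 t * (K t - T t) = \<bar>K t - T t\<bar> \<and> \<psi>0 (t + pi / real m) = - \<psi>0 t"
    using assms(3) unfolding B_star_with_def by blast
  obtain \<psi>1 where \<psi>1: "\<psi>1 \<in> borel_measurable borel" "periodic \<psi>1" "AE x in lebesgue. \<psi>0 x = \<psi>1 x"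
    using \<psi>0 by (auto simp: Lp_def periodic_def intro: periodic_borel_version)
  note [measurable] = \<psi>1(1) K'(1)
  define \<psi> where "\<psi> t = max (-1) (min 1 (\<psi>1 t))" for t
  have \<psi>: "\<psi> \<in> borel_measurable borel" "periodic \<psi>" "\<bar>\<psi> t\<bar> \<le> 1" for t
    using \<psi>1(2) by (auto simp: \<psi>_def[abs_def] periodic_def)
  have \<psi>eq: "AE t in lebesgue. \<psi>0 t = \<psi> t"
    using \<psi>1(3) ae by eventually_elim (auto simp: \<psi>_def max_def min_def abs_le_iff)
  have \<psi>eq': "AE t in lebesgue. \<psi>0 (t + pi / real m) = \<psi> (t + pi / real m)"
    using AE_lebesgue_affine[OF \<psi>eq, of 1 "pi / real m"] by (simp add: add.commute)
  have "AE t in lebesgue. \<psi> t * (K' t - T t) = \<bar>K' t - T t\<bar>" "AE t in lebesgue. \<psi> (t + pi / real m) = - \<psi> t"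
    using ae \<psi>eq \<psi>eq' K'(2) by (eventually_elim, metis)+
  note ae\<psi> = this[THEN AE_lebesgue_imp_circ]
  have cong: "Lp_norm 1 (\<lambda>t. K t - S t) = Lp_norm 1 (\<lambda>t. K' t - S t)" if "S \<in> trig_polys n" for S
  proof (rule Lp_norm_cong_AE)
    have S: "S \<in> borel_measurable lebesgue" using that by (intro borel_imp_lebesgue trig_polys_borel)
    show "(\<lambda>t. K t - S t) \<in> borel_measurable lebesgue" "(\<lambda>t. K' t - S t) \<in> borel_measurable lebesgue"
      using S K(1) borel_imp_lebesgue[OF K'(1)] by auto
    show "AE t in lebesgue. K t - S t = K' t - S t" using K'(2) by eventually_elim simp
  qed
  have "Lp_norm 1 K' < \<infinity>"
    using K(3) Lp_norm_cong_AE[OF K(1) borel_imp_lebesgue[OF K'(1)] K'(2)] by simp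
  then have "integrable circ K'" using K'(1) by (simp add: integrable_iff_Lp_norm_1 borel_imp_circ)
  then interpret B: borel_B_star n m K' T \<psi>
    using assms(1) m K'(1) T \<psi> ae\<psi> by unfold_locales
  have best: "best_approx n 1 K = best_approx n 1 K'"
    unfolding best_approx_def using cong by (rule INF_cong[OF refl])
  have c: "ennreal (B.M / (2 * pi)) = ennreal (1 / (2 * pi)) * ennreal B.M"
    by (subst ennreal_mult[symmetric]) (auto simp: B.M_def)
  note cc = conv_class_borel[OF K(1) K']
  show ?thesis
    unfolding cc image_image best cong[OF T] B.best_approx_1 B.Lp_norm_1_diff
    using B.SUP_conv_eq[of \<infinity>, OF _ assms(4)] B.SUP_conv_eq[of 1, OF _ assms(4)]
    by (simp add: c)
qed

end
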